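(* Let $\mathcal{H}$ be a separable Hilbert space and let $(C_1,\ldots,C_k)\in B(\mathcal{H})^k$ be a commuting tuple of operators such that the spectral radius $r(C_i)<1$ for each $i\in\{1,\ldots,k\}$. Let $S_1,\ldots,S_k$ be the unilateral shifts on the Hardy space $H^2(\mathbb{D}^k)$ of the polydisc, and set $$b:=\prod_{i=1}^k\left(\sum_{s_i=0}^\infty\|C_i^{s_i}\|^2\right).$$ Then there exist a closed subspace $\mathcal{G}\subset H^2(\mathbb{D}^k)\otimes\mathcal{H}$ invariant under each operator $S_i^*\otimes I_{\mathcal{H}}$ and an invertible operator $Y:\mathcal{H}\to\mathcal{G}$ such that $$C_i^*=Y^{-1}[(S_i^*\otimes I_{\mathcal{H}})|_{\mathcal{G}}]Y,\qquad i\in\{1,\ldots,k\}.$$ Moreover, $$\|[q_{s,t}(C_1,\ldots,C_k)]_{m\times m}\|\leq\sqrt{b}\,\sup_{|z_i|\leq1}\|[q_{s,t}(z_1,\ldots,z_k)]_{m\times m}\|$$ for any matrix $[q_{s,t}]_{m\times m}$ of polynomials in $k$ variables and any $m\in\mathbb{N}$.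
   Context: $S_i$ is the operator of multiplication by the coordinate function $z_i$ on $H^2(\mathbb{D}^k)$. The norm of an $m\times m$ operator matrix is its norm as an operator on the $m$-fold direct sum $\mathcal{H}^{(m)}$, and of a scalar matrix its operator norm on $\mathbb{C}^m$. *)

theory Defs
  imports "HOL-Analysis.Analysis" "HOL-Library.Poly_Mapping"
begin

section \<open>Complex Hilbert spaces and bounded operators\<close>

text \<open>
  The norm, the metric and completeness of a complex Hilbert space are those of the underlying
  real Hilbert space, whose inner product is the real part of the complex one.  The complex inner
  product is linear in the first argument.
\<close>

class chilbert_space = real_inner + complete_space +
  fixes scaleC :: "complex \<Rightarrow> 'a \<Rightarrow> 'a"  (infixr "*\<^sub>C" 75)
    and cinner :: "'a \<Rightarrow> 'a \<Rightarrow> complex"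
  assumes scaleC_add_right: "c *\<^sub>C (x + y) = c *\<^sub>C x + c *\<^sub>C y"
    and scaleC_add_left: "(c + d) *\<^sub>C x = c *\<^sub>C x + d *\<^sub>C x"
    and scaleC_scaleC: "c *\<^sub>C (d *\<^sub>C x) = (c * d) *\<^sub>C x"
    and scaleC_of_real: "complex_of_real r *\<^sub>C x = r *\<^sub>R x"
    and cinner_add_left: "cinner (x + y) z = cinner x z + cinner y z"
    and cinner_scaleC_left: "cinner (c *\<^sub>C x) y = c * cinner x y"
    and cinner_commute: "cinner y x = cnj (cinner x y)"
    and Re_cinner: "Re (cinner x y) = inner x y"

lemma scaleC_one: "1 *\<^sub>C x = (x :: 'a::chilbert_space)"
  using scaleC_of_real[of 1 x] by simp

global_interpretation complex_vector:
  vector_space "scaleC :: complex \<Rightarrow> 'a \<Rightarrow> 'a::chilbert_space"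
  by unfold_locales (simp_all add: scaleC_add_right scaleC_add_left scaleC_scaleC scaleC_one)

instantiation complex :: chilbert_space
begin

definition scaleC_complex :: "complex \<Rightarrow> complex \<Rightarrow> complex"
  where "scaleC_complex c x = c * x"

definition cinner_complex :: "complex \<Rightarrow> complex \<Rightarrow> complex"
  where "cinner_complex x y = x * cnj y"

instance
  by standard
    (simp_all add: scaleC_complex_def cinner_complex_def algebra_simps inner_complex_def
      scaleR_conv_of_real)

end

text \<open>Operators are total functions between types; their norm is \<^const>\<open>onorm\<close>.\<close>

definition bounded_clinear :: "('a::chilbert_space \<Rightarrow> 'b::chilbert_space) \<Rightarrow> bool"
  where "bounded_clinear T \<longleftrightarrow> bounded_linear T \<and> (\<forall>c x. T (c *\<^sub>C x) = c *\<^sub>C T x)"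

definition adj :: "('a::chilbert_space \<Rightarrow> 'b::chilbert_space) \<Rightarrow> 'b \<Rightarrow> 'a"
  where "adj T = (THE T'. \<forall>x y. cinner (T x) y = cinner x (T' y))"

definition spectrum :: "('a::chilbert_space \<Rightarrow> 'a) \<Rightarrow> complex set"
  where "spectrum T = {c. \<not> (\<exists>R. bounded_clinear R \<and>
           (\<forall>x. R (c *\<^sub>C x - T x) = x) \<and> (\<forall>x. c *\<^sub>C R x - T (R x) = x))}"

text \<open>
  The element 0 only matters when the space is trivial and the spectrum therefore empty.
\<close>

definition spectral_radius :: "('a::chilbert_space \<Rightarrow> 'a) \<Rightarrow> real"
  where "spectral_radius T = Sup (insert 0 (cmod ` spectrum T))"

text \<open>
  A bounded invertible operator from the whole space onto a subset \<open>G\<close> of the codomain.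
\<close>

definition invertible_onto :: "('a::chilbert_space \<Rightarrow> 'b::chilbert_space) \<Rightarrow> 'b set \<Rightarrow> bool"
  where "invertible_onto Y G \<longleftrightarrow> bounded_clinear Y \<and> bij_betw Y UNIV G \<and>
           (\<exists>K. \<forall>y\<in>G. norm (inv Y y) \<le> K * norm y)"

text \<open>
  The type \<^typ>\<open>'a ^ 'm\<close> carries the Euclidean norm, so it is the Hilbert direct sum of
  \<open>CARD('m)\<close> copies of \<^typ>\<open>'a\<close>.
\<close>

definition op_matrix :: "('m \<Rightarrow> 'm \<Rightarrow> 'a \<Rightarrow> 'a) \<Rightarrow> 'a ^ 'm \<Rightarrow> 'a::chilbert_space ^ 'm::finite"
  where "op_matrix A v = (\<chi> s. \<Sum>t\<in>UNIV. A s t (v $ t))"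


section \<open>Hilbert space tensor products\<close>

text \<open>
  \<open>hilbert_tensor_product t\<close> states that the codomain, with \<open>t a b\<close> as the elementary tensor
  of \<open>a\<close> and \<open>b\<close>, is the Hilbert space tensor product of the two domains.  This determines it
  up to a unique unitary operator matching elementary tensors.  The operator
  \<open>tensor_op t A B\<close> is the bounded operator usually written \<open>A \<otimes> B\<close>.
\<close>

definition hilbert_tensor_product ::
    "('a::chilbert_space \<Rightarrow> 'b::chilbert_space \<Rightarrow> 'e::chilbert_space) \<Rightarrow> bool"
  where "hilbert_tensor_product t \<longleftrightarrow>
     (\<forall>a a' b. t (a + a') b = t a b + t a' b) \<and>
     (\<forall>a b b'. t a (b + b') = t a b + t a b') \<and>
     (\<forall>c a b. t (c *\<^sub>C a) b = c *\<^sub>C t a b \<and> t a (c *\<^sub>C b) = c *\<^sub>C t a b) \<and>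
     (\<forall>a b a' b'. cinner (t a b) (t a' b') = cinner a a' * cinner b b') \<and>
     closure (complex_vector.span {t a b | a b. True}) = UNIV"

definition tensor_op ::
    "('a::chilbert_space \<Rightarrow> 'b::chilbert_space \<Rightarrow> 'e::chilbert_space) \<Rightarrow>
     ('a \<Rightarrow> 'a) \<Rightarrow> ('b \<Rightarrow> 'b) \<Rightarrow> 'e \<Rightarrow> 'e"
  where "tensor_op t A B =
     (THE T. bounded_clinear T \<and> (\<forall>a b. T (t a b) = t (A a) (B b)))"


section \<open>Polynomials in several variables\<close>

text \<open>
  The \<open>k\<close> variables are indexed by a finite type \<^typ>\<open>'k\<close>.  A polynomial is its finitely
  supported family of coefficients, indexed by the multi-indices \<^typ>\<open>'k \<Rightarrow> nat\<close>.
\<close>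

type_synonym 'k mpoly = "('k \<Rightarrow> nat) \<Rightarrow>\<^sub>0 complex"

definition mpow :: "complex ^ 'k \<Rightarrow> ('k::finite \<Rightarrow> nat) \<Rightarrow> complex"
  where "mpow z \<alpha> = (\<Prod>i\<in>UNIV. (z $ i) ^ \<alpha> i)"

definition mpoly_eval :: "'k::finite mpoly \<Rightarrow> complex ^ 'k \<Rightarrow> complex"
  where "mpoly_eval q z = (\<Sum>\<alpha>\<in>Poly_Mapping.keys q. Poly_Mapping.lookup q \<alpha> * mpow z \<alpha>)"

text \<open>
  The composite of all the powers \<open>C i ^^ \<alpha> i\<close>; the fold does not depend on the order of the
  factors as long as the operators \<open>C i\<close> commute.
\<close>

definition op_mpow :: "('k::finite \<Rightarrow> 'a \<Rightarrow> 'a) \<Rightarrow> ('k \<Rightarrow> nat) \<Rightarrow> 'a \<Rightarrow> 'a"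
  where "op_mpow C \<alpha> = Finite_Set.fold (\<lambda>i T. (C i ^^ \<alpha> i) \<circ> T) id UNIV"

definition mpoly_op :: "'k::finite mpoly \<Rightarrow> ('k \<Rightarrow> 'a \<Rightarrow> 'a) \<Rightarrow> 'a \<Rightarrow> 'a::chilbert_space"
  where "mpoly_op q C x = (\<Sum>\<alpha>\<in>Poly_Mapping.keys q. Poly_Mapping.lookup q \<alpha> *\<^sub>C op_mpow C \<alpha> x)"


section \<open>The Hardy space of the polydisc\<close>

definition polydisc :: "(complex ^ 'k::finite) set"
  where "polydisc = {z. \<forall>i. cmod (z $ i) < 1}"

definition ell2 :: "(('k \<Rightarrow> nat) \<Rightarrow> complex) set"
  where "ell2 = {a. (\<lambda>\<alpha>. (cmod (a \<alpha>))\<^sup>2) summable_on UNIV}"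

definition has_taylor :: "(complex ^ 'k::finite \<Rightarrow> complex) \<Rightarrow> (('k \<Rightarrow> nat) \<Rightarrow> complex) \<Rightarrow> bool"
  where "has_taylor f a \<longleftrightarrow> (\<forall>z\<in>polydisc. ((\<lambda>\<alpha>. a \<alpha> * mpow z \<alpha>) has_sum f z) UNIV)"

text \<open>
  The Hardy space consists of the sums on the polydisc of the power series with square summable
  coefficients; its inner product, defined below, is that of the coefficient families.  Functions
  on the polydisc are represented by their extension by 0 to the whole space.
\<close>

typedef (overloaded) ('k::finite) hardy =
  "{f :: complex ^ 'k \<Rightarrow> complex. (\<exists>a\<in>ell2. has_taylor f a) \<and> (\<forall>z. z \<notin> polydisc \<longrightarrow> f z = 0)}"
  morphisms hardy_fun Abs_hardy
proof -
  have "(\<lambda>_. 0) \<in> ell2" by (simp add: ell2_def)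
  moreover have "has_taylor (\<lambda>_. 0) (\<lambda>_. 0)" by (simp add: has_taylor_def)
  ultimately show ?thesis by (intro exI[of _ "\<lambda>_. 0"]) auto
qed

setup_lifting type_definition_hardy

lemma hardy_fun_outside: "z \<notin> polydisc \<Longrightarrow> hardy_fun f z = 0"
  using hardy_fun[of f] by blast

lemma mpow_summable:
  assumes "z \<in> polydisc"
  shows "(\<lambda>\<alpha>. (cmod (mpow z \<alpha>))\<^sup>2) summable_on UNIV"
proof -
  have geom: "(\<lambda>n. norm ((cmod (z $ i))\<^sup>2 ^ n)) summable_on UNIV" for i
  proof -
    have "(cmod (z $ i))\<^sup>2 < 1"
      using assms by (simp add: polydisc_def power_less_one_iff)
    then have "summable (\<lambda>n. (cmod (z $ i))\<^sup>2 ^ n)" by (intro summable_geometric) simp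
    then show ?thesis
      by (intro norm_summable_imp_summable_on) (simp add: norm_power)
  qed
  have "Infinite_Sum.abs_summable_on (\<lambda>\<alpha>. \<Prod>i\<in>UNIV. (cmod (z $ i))\<^sup>2 ^ \<alpha> i) (PiE UNIV (\<lambda>_. UNIV))"
    using geom unfolding abs_summable_equivalent by (intro abs_summable_on_prod_PiE) auto
  then have "(\<lambda>\<alpha>. \<Prod>i\<in>UNIV. (cmod (z $ i))\<^sup>2 ^ \<alpha> i) summable_on UNIV"
    by (simp add: PiE_UNIV_domain abs_summable_summable)
  moreover have "(cmod (mpow z \<alpha>))\<^sup>2 = (\<Prod>i\<in>UNIV. (cmod (z $ i))\<^sup>2 ^ \<alpha> i)" for \<alpha>
    unfolding mpow_def prod_norm[symmetric] norm_power prod_power_distrib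
    by (intro prod.cong) (simp_all add: power_mult[symmetric] mult.commute)
  ultimately show ?thesis by (simp only:)
qed

lemma ell2_mult_summable:
  assumes "(\<lambda>i. (cmod (a i))\<^sup>2) summable_on UNIV" "(\<lambda>i. (cmod (b i))\<^sup>2) summable_on UNIV"
  shows "(\<lambda>i. a i * b i) summable_on UNIV"
proof -
  have "(\<lambda>i. norm (a i * b i)) summable_on UNIV"
    by (rule abs_summable_product) (use assms in \<open>simp_all add: norm_mult power2_eq_square\<close>)
  then show ?thesis by (rule abs_summable_summable)
qed

lemma ell2_add: "a \<in> ell2 \<Longrightarrow> b \<in> ell2 \<Longrightarrow> (\<lambda>\<alpha>. a \<alpha> + b \<alpha>) \<in> ell2"
proof -
  assume a: "a \<in> ell2" and b: "b \<in> ell2"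
  have le: "(cmod (x + y))\<^sup>2 \<le> 2 * (cmod x)\<^sup>2 + 2 * (cmod y)\<^sup>2" for x y
  proof -
    have "(cmod (x + y))\<^sup>2 \<le> (cmod x + cmod y)\<^sup>2"
      by (intro power_mono norm_triangle_ineq) simp
    also have "\<dots> \<le> 2 * (cmod x)\<^sup>2 + 2 * (cmod y)\<^sup>2"
      using sum_squares_bound[of "cmod x" "cmod y"] by (simp add: power2_sum)
    finally show ?thesis .
  qed
  have "(\<lambda>\<alpha>. 2 * (cmod (a \<alpha>))\<^sup>2 + 2 * (cmod (b \<alpha>))\<^sup>2) summable_on UNIV"
    using a b by (intro summable_on_add summable_on_cmult_right) (auto simp: ell2_def)
  then show ?thesis
    unfolding ell2_def mem_Collect_eq by (rule summable_on_comparison_test) (auto intro: le)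
qed

lemma ell2_cmult: "a \<in> ell2 \<Longrightarrow> (\<lambda>\<alpha>. c * a \<alpha>) \<in> ell2"
  by (simp add: ell2_def norm_mult power_mult_distrib summable_on_cmult_right)

lemma one_var_unique:
  fixes c :: "nat \<Rightarrow> complex"
  assumes "\<And>t. cmod t < 1 \<Longrightarrow> ((\<lambda>n. c n * t ^ n) has_sum 0) UNIV"
  shows "c n = 0"
proof -
  define F where "F = Abs_fps c"
  have s: "(\<lambda>n. c n * t ^ n) sums 0" if "cmod t < 1" for t
    using assms[OF that] by (rule has_sum_imp_sums)
  have "fps_conv_radius F \<ge> norm (1/2 :: complex)"
    unfolding fps_conv_radius_def
    by (rule conv_radius_geI) (use s[of "1/2"] in \<open>auto simp: F_def sums_iff\<close>)
  then have r: "fps_conv_radius F > 0"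
    by (rule less_le_trans[rotated]) simp
  have "eventually (\<lambda>t::complex. t \<in> ball 0 1) (nhds 0)"
    by (intro eventually_nhds_in_open) auto
  then have "eventually (\<lambda>t. eval_fps F t = eval_fps 0 t) (nhds 0)"
  proof eventually_elim
    case (elim t)
    then show ?case using s[of t] by (simp add: eval_fps_def F_def sums_iff)
  qed
  then have "F = 0" using r by (intro eval_fps_eqD) auto
  then show ?thesis by (simp add: F_def fps_eq_iff)
qed

lemma taylor_zero:
  fixes a :: "('k::finite \<Rightarrow> nat) \<Rightarrow> complex"
  assumes "has_taylor (\<lambda>_. 0) a"
  shows "a m = 0"
proof -
  let ?S = "\<lambda>J m. {\<alpha>::'k \<Rightarrow> nat. \<forall>j\<in>J. \<alpha> j = m j}"
  let ?f = "\<lambda>J z \<alpha>. a \<alpha> * (\<Prod>j\<in>-J. (z $ j) ^ \<alpha> j)"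
  have summ: "?f J z summable_on ?S J m" if z: "z \<in> polydisc" for J m z
  proof -
    define w :: "complex ^ 'k" where "w = (\<chi> j. if j \<in> J then 1/2 else z $ j)"
    have w: "w \<in> polydisc" using z by (auto simp: polydisc_def w_def)
    have "(\<lambda>\<alpha>. a \<alpha> * mpow w \<alpha>) summable_on UNIV"
      using assms w by (auto simp: has_taylor_def summable_on_def)
    then have "(\<lambda>\<alpha>. a \<alpha> * mpow w \<alpha>) summable_on ?S J m"
      by (rule summable_on_subset_banach) simp
    then have "(\<lambda>\<alpha>. (\<Prod>j\<in>J. 2 ^ m j) * (a \<alpha> * mpow w \<alpha>)) summable_on ?S J m"
      by (rule summable_on_cmult_right)
    also have "?this \<longleftrightarrow> ?f J z summable_on ?S J m"
    proof (rule summable_on_cong)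
      fix \<alpha> assume \<alpha>: "\<alpha> \<in> ?S J m"
      have "mpow w \<alpha> = (\<Prod>j\<in>J. (w $ j) ^ \<alpha> j) * (\<Prod>j\<in>-J. (w $ j) ^ \<alpha> j)"
        unfolding mpow_def by (subst prod.union_disjoint[symmetric]) (auto simp: Compl_partition)
      also have "(\<Prod>j\<in>J. (w $ j) ^ \<alpha> j) = (\<Prod>j\<in>J. (1/2) ^ m j)"
        using \<alpha> by (intro prod.cong) (auto simp: w_def)
      also have "(\<Prod>j\<in>-J. (w $ j) ^ \<alpha> j) = (\<Prod>j\<in>-J. (z $ j) ^ \<alpha> j)"
        by (intro prod.cong) (auto simp: w_def)
      finally show "(\<Prod>j\<in>J. 2 ^ m j) * (a \<alpha> * mpow w \<alpha>) = ?f J z \<alpha>"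
        by (simp add: power_one_over prod_dividef)
    qed
    finally show ?thesis .
  qed
  have "\<forall>m. \<forall>z\<in>polydisc. (?f J z has_sum 0) (?S J m)" for J
    using finite[of J]
  proof (induction J rule: finite_induct)
    case empty
    then show ?case using assms by (auto simp: has_taylor_def mpow_def)
  next
    case (insert i J)
    show ?case
    proof (intro allI ballI)
      fix m :: "'k \<Rightarrow> nat" and z :: "complex ^ 'k" assume z: "z \<in> polydisc"
      let ?B = "\<lambda>n. ?S (insert i J) (m(i := n))"
      define c where "c n = infsum (?f (insert i J) z) (?B n)" for n
      have c: "(?f (insert i J) z has_sum c n) (?B n)" for n
        unfolding c_def by (intro has_sum_infsum summ z)
      have "((\<lambda>n. c n * t ^ n) has_sum 0) UNIV" if t: "cmod t < 1" for t
      proof -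
        define w :: "complex ^ 'k" where "w = (\<chi> j. if j = i then t else z $ j)"
        have w: "w \<in> polydisc" using z t by (auto simp: polydisc_def w_def)
        have "(?f J w has_sum 0) (?S J m)" using insert.IH w by blast
        moreover have "bij_betw snd (Sigma UNIV ?B) (?S J m)"
          by (rule bij_betwI[where g = "\<lambda>\<alpha>. (\<alpha> i, \<alpha>)"]) (use insert.hyps in auto)
        ultimately have 1: "((\<lambda>p. ?f J w (snd p)) has_sum 0) (Sigma UNIV ?B)"
          using has_sum_reindex_bij_betw[of snd "Sigma UNIV ?B" "?S J m" "?f J w" 0] by blast
        have 2: "(?f J w has_sum c n * t ^ n) (?B n)" for n
        proof -
          have "((\<lambda>\<alpha>. ?f (insert i J) z \<alpha> * t ^ n) has_sum c n * t ^ n) (?B n)"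
            by (intro has_sum_cmult_left c)
          also have "?this \<longleftrightarrow> ?thesis"
          proof (rule has_sum_cong)
            fix \<alpha> assume \<alpha>: "\<alpha> \<in> ?B n"
            have J: "- J = insert i (- insert i J)" using insert.hyps by auto
            have "(\<Prod>j\<in>-J. (w $ j) ^ \<alpha> j) =
                (w $ i) ^ \<alpha> i * (\<Prod>j\<in>- insert i J. (w $ j) ^ \<alpha> j)"
              unfolding J by (rule prod.insert) auto
            also have "(\<Prod>j\<in>- insert i J. (w $ j) ^ \<alpha> j) = (\<Prod>j\<in>- insert i J. (z $ j) ^ \<alpha> j)"
              by (intro prod.cong) (auto simp: w_def)
            also have "(w $ i) ^ \<alpha> i = t ^ n" using \<alpha> by (simp add: w_def)
            finally show "?f (insert i J) z \<alpha> * t ^ n = ?f J w \<alpha>" by simp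
          qed
          finally show ?thesis .
        qed
        from has_sum_SigmaD[OF 1, of "\<lambda>n. c n * t ^ n"] 2 show ?thesis by simp
      qed
      then have "c (m i) = 0" by (rule one_var_unique)
      with c[of "m i"] show "(?f (insert i J) z has_sum 0) (?S (insert i J) m)"
        by (simp add: fun_upd_triv)
    qed
  qed
  moreover have "(0 :: complex ^ 'k) \<in> polydisc" by (simp add: polydisc_def)
  ultimately have "(?f UNIV 0 has_sum 0) (?S UNIV m)" by blast
  moreover have "?S UNIV m = {m}" by auto
  moreover have "?f UNIV 0 = a" by simp
  ultimately have "(a has_sum 0) {m}" by (simp only:)
  moreover have "(a has_sum a m) {m}" using has_sum_finite[of "{m}" a] by simp
  ultimately show ?thesis by (rule has_sum_unique[rotated])
qed

text \<open>The Taylor coefficients of a function in the Hardy space.\<close>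

definition hcoef :: "'k::finite hardy \<Rightarrow> ('k \<Rightarrow> nat) \<Rightarrow> complex"
  where "hcoef f = (THE a. has_taylor (hardy_fun f) a)"

definition of_hcoef :: "(('k \<Rightarrow> nat) \<Rightarrow> complex) \<Rightarrow> 'k::finite hardy"
  where "of_hcoef a =
    Abs_hardy (\<lambda>z. if z \<in> polydisc then \<Sum>\<^sub>\<infinity>\<alpha>. a \<alpha> * mpow z \<alpha> else 0)"

lemma has_taylor_unique:
  fixes f :: "complex ^ 'k::finite \<Rightarrow> complex"
  assumes "has_taylor f a" "has_taylor f b"
  shows "a = b"
proof
  fix m
  have "has_taylor (\<lambda>_. 0) (\<lambda>\<alpha>. a \<alpha> - b \<alpha>)"
    unfolding has_taylor_def
  proof
    fix z :: "complex ^ 'k" assume "z \<in> polydisc"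
    then have "((\<lambda>\<alpha>. a \<alpha> * mpow z \<alpha>) has_sum f z) UNIV"
      and "((\<lambda>\<alpha>. - (b \<alpha> * mpow z \<alpha>)) has_sum - f z) UNIV"
      using assms by (auto simp: has_taylor_def has_sum_uminus)
    from has_sum_add[OF this] show "((\<lambda>\<alpha>. (a \<alpha> - b \<alpha>) * mpow z \<alpha>) has_sum 0) UNIV"
      by (simp add: algebra_simps)
  qed
  from taylor_zero[OF this, of m] show "a m = b m" by simp
qed

lemma has_taylor_hcoef: "has_taylor (hardy_fun f) (hcoef f)"
  and hcoef_ell2: "hcoef f \<in> ell2"
proof -
  obtain a where a: "a \<in> ell2" "has_taylor (hardy_fun f) a"
    using hardy_fun[of f] by blast
  then have "hcoef f = a" unfolding hcoef_def using has_taylor_unique by blast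
  with a show "has_taylor (hardy_fun f) (hcoef f)" "hcoef f \<in> ell2" by simp_all
qed

lemma has_taylor_imp_hcoef: "has_taylor (hardy_fun f) a \<Longrightarrow> hcoef f = a"
  using has_taylor_hcoef has_taylor_unique by blast

lemma hcoef_Abs:
  assumes "a \<in> ell2" "has_taylor f a" "\<And>z. z \<notin> polydisc \<Longrightarrow> f z = 0"
  shows "hcoef (Abs_hardy f) = a"
  by (rule has_taylor_imp_hcoef) (use assms in \<open>subst Abs_hardy_inverse; auto\<close>)

lemma hcoef_of_hcoef: "a \<in> ell2 \<Longrightarrow> hcoef (of_hcoef a) = a"
  unfolding of_hcoef_def
  by (rule hcoef_Abs)
    (auto simp: has_taylor_def ell2_def intro!: has_sum_infsum ell2_mult_summable mpow_summable)

lemma hardy_eqI: "hcoef f = hcoef g \<Longrightarrow> f = g"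
proof -
  assume eq: "hcoef f = hcoef g"
  have "hardy_fun f z = hardy_fun g z" for z
  proof (cases "z \<in> polydisc")
    case True
    then show ?thesis
      using has_taylor_hcoef[of f] has_taylor_hcoef[of g] eq
      unfolding has_taylor_def by (metis has_sum_unique)
  qed (simp add: hardy_fun_outside)
  then have "hardy_fun f = hardy_fun g" by (rule ext)
  then show "f = g" by (simp add: hardy_fun_inject)
qed


subsection \<open>Hilbert space structure\<close>

lemma has_taylor_add:
  "has_taylor f a \<Longrightarrow> has_taylor g b \<Longrightarrow> has_taylor (\<lambda>z. f z + g z) (\<lambda>\<alpha>. a \<alpha> + b \<alpha>)"
  by (auto simp: has_taylor_def algebra_simps intro!: has_sum_add)

lemma has_taylor_cmult: "has_taylor f a \<Longrightarrow> has_taylor (\<lambda>z. c * f z) (\<lambda>\<alpha>. c * a \<alpha>)"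
  by (auto simp: has_taylor_def mult.assoc intro!: has_sum_cmult_right)

instantiation hardy :: (finite) real_inner
begin

definition zero_hardy :: "'a hardy"
  where "0 = Abs_hardy (\<lambda>_. 0)"

definition plus_hardy :: "'a hardy \<Rightarrow> 'a hardy \<Rightarrow> 'a hardy"
  where "f + g = Abs_hardy (\<lambda>z. hardy_fun f z + hardy_fun g z)"

definition scaleR_hardy :: "real \<Rightarrow> 'a hardy \<Rightarrow> 'a hardy"
  where "r *\<^sub>R f = Abs_hardy (\<lambda>z. complex_of_real r * hardy_fun f z)"

definition uminus_hardy :: "'a hardy \<Rightarrow> 'a hardy"
  where "- f = (- 1) *\<^sub>R (f :: 'a hardy)"

definition minus_hardy :: "'a hardy \<Rightarrow> 'a hardy \<Rightarrow> 'a hardy"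
  where "f - g = f + - (g :: 'a hardy)"

definition inner_hardy :: "'a hardy \<Rightarrow> 'a hardy \<Rightarrow> real"
  where "inner f g = Re (\<Sum>\<^sub>\<infinity>\<alpha>. hcoef f \<alpha> * cnj (hcoef g \<alpha>))"

definition norm_hardy :: "'a hardy \<Rightarrow> real"
  where "norm f = sqrt (inner f (f :: 'a hardy))"

definition dist_hardy :: "'a hardy \<Rightarrow> 'a hardy \<Rightarrow> real"
  where "dist f g = norm (f - (g :: 'a hardy))"

definition sgn_hardy :: "'a hardy \<Rightarrow> 'a hardy"
  where "sgn f = inverse (norm f) *\<^sub>R (f :: 'a hardy)"

definition uniformity_hardy :: "('a hardy \<times> 'a hardy) filter"
  where "uniformity = (INF e\<in>{0<..}. principal {(x :: 'a hardy, y). dist x y < e})"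

definition open_hardy :: "'a hardy set \<Rightarrow> bool"
  where "open U = (\<forall>x\<in>U. eventually (\<lambda>(x', y). x' = x \<longrightarrow> y \<in> U)
    (uniformity :: ('a hardy \<times> 'a hardy) filter))"

lemma hcoef_zero [simp]: "hcoef (0 :: 'a hardy) = (\<lambda>_. 0)"
  unfolding zero_hardy_def by (rule hcoef_Abs) (auto simp: ell2_def has_taylor_def)

lemma hcoef_add: "hcoef (f + g :: 'a hardy) = (\<lambda>\<alpha>. hcoef f \<alpha> + hcoef g \<alpha>)"
  unfolding plus_hardy_def
  by (rule hcoef_Abs)
    (auto simp: hardy_fun_outside intro: ell2_add hcoef_ell2 has_taylor_add has_taylor_hcoef)

lemma hcoef_scaleR: "hcoef (r *\<^sub>R f :: 'a hardy) = (\<lambda>\<alpha>. complex_of_real r * hcoef f \<alpha>)"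
  unfolding scaleR_hardy_def
  by (rule hcoef_Abs)
    (auto simp: hardy_fun_outside intro: ell2_cmult hcoef_ell2 has_taylor_cmult has_taylor_hcoef)

lemma hcoef_diff: "hcoef (f - g :: 'a hardy) = (\<lambda>\<alpha>. hcoef f \<alpha> - hcoef g \<alpha>)"
  by (simp add: minus_hardy_def uminus_hardy_def hcoef_add hcoef_scaleR)

lemma hcoef_summable: "(\<lambda>\<alpha>. (cmod (hcoef f \<alpha>))\<^sup>2) summable_on UNIV"
  using hcoef_ell2[of f] by (simp add: ell2_def)

lemma hcoef_mult_summable: "(\<lambda>\<alpha>. hcoef f \<alpha> * cnj (hcoef g \<alpha>)) summable_on UNIV"
  by (rule ell2_mult_summable) (simp_all add: hcoef_summable)

lemma inner_hardy_self: "inner (f :: 'a hardy) f = (\<Sum>\<^sub>\<infinity>\<alpha>. (cmod (hcoef f \<alpha>))\<^sup>2)"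
proof -
  have "inner f f = (\<Sum>\<^sub>\<infinity>\<alpha>. Re (hcoef f \<alpha> * cnj (hcoef f \<alpha>)))"
    unfolding inner_hardy_def by (rule infsum_Re[OF hcoef_mult_summable, symmetric])
  also have "\<dots> = (\<Sum>\<^sub>\<infinity>\<alpha>. (cmod (hcoef f \<alpha>))\<^sup>2)"
    by (intro infsum_cong) (simp add: cmod_power2 flip: power2_eq_square)
  finally show ?thesis .
qed

lemma hcoef_sum_le:
  assumes "finite F"
  shows "(\<Sum>\<alpha>\<in>F. (cmod (hcoef (f :: 'a hardy) \<alpha>))\<^sup>2) \<le> (norm f)\<^sup>2"
  using assms infsum_nonneg[of UNIV "\<lambda>\<alpha>. (cmod (hcoef f \<alpha>))\<^sup>2"]
  by (auto simp: norm_hardy_def inner_hardy_self intro!: finite_sum_le_infsum hcoef_summable)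

lemma hcoef_le: "cmod (hcoef (f :: 'a hardy) \<alpha>) \<le> norm f"
  using hcoef_sum_le[of "{\<alpha>}" f] infsum_nonneg[of UNIV "\<lambda>\<alpha>. (cmod (hcoef f \<alpha>))\<^sup>2"]
  by (auto intro: power2_le_imp_le simp: norm_hardy_def inner_hardy_self)

lemma norm_hardy_leI:
  assumes "\<And>F. finite F \<Longrightarrow> (\<Sum>\<alpha>\<in>F. (cmod (hcoef f \<alpha>))\<^sup>2) \<le> e\<^sup>2" "e \<ge> 0"
  shows "norm (f :: 'a hardy) \<le> e"
proof -
  have "(\<Sum>\<^sub>\<infinity>\<alpha>. (cmod (hcoef f \<alpha>))\<^sup>2) \<le> e\<^sup>2"
    by (rule infsum_le_finite_sums) (use assms hcoef_summable in auto)
  then show ?thesis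
    using assms by (simp add: norm_hardy_def inner_hardy_self real_le_lsqrt)
qed

instance
proof
  fix f g h :: "'a hardy" and r s :: real
  show "f + g + h = f + (g + h)" "f + g = g + f" "0 + f = f" "- f + f = 0" "f - g = f + - g"
    by (rule hardy_eqI; simp add: hcoef_add hcoef_scaleR uminus_hardy_def minus_hardy_def algebra_simps)+
  show "r *\<^sub>R (f + g) = r *\<^sub>R f + r *\<^sub>R g" "(r + s) *\<^sub>R f = r *\<^sub>R f + s *\<^sub>R f"
    "r *\<^sub>R s *\<^sub>R f = (r * s) *\<^sub>R f" "1 *\<^sub>R f = f"
    by (rule hardy_eqI; simp add: hcoef_add hcoef_scaleR algebra_simps)+
  show "dist f g = norm (f - g)" by (rule dist_hardy_def)
  show "sgn f = inverse (norm f) *\<^sub>R f" by (rule sgn_hardy_def)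
  show "uniformity = (INF e\<in>{0<..}. principal {(x :: 'a hardy, y). dist x y < e})"
    by (rule uniformity_hardy_def)
  show "open U = (\<forall>x\<in>U. eventually (\<lambda>(x', y). x' = x \<longrightarrow> y \<in> U) uniformity)" for U :: "'a hardy set"
    by (rule open_hardy_def)
  have "(\<Sum>\<^sub>\<infinity>\<alpha>. hcoef g \<alpha> * cnj (hcoef f \<alpha>)) = cnj (\<Sum>\<^sub>\<infinity>\<alpha>. hcoef f \<alpha> * cnj (hcoef g \<alpha>))"
    by (subst infsum_cnj[symmetric]) (simp add: mult.commute)
  then show "inner f g = inner g f" by (simp add: inner_hardy_def)
  show "inner (f + g) h = inner f h + inner g h"
    by (simp add: inner_hardy_def hcoef_add distrib_right infsum_add hcoef_mult_summable)
  show "inner (r *\<^sub>R f) g = r * inner f g"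
    by (simp add: inner_hardy_def hcoef_scaleR mult.assoc infsum_cmult_right')
  show "0 \<le> inner f f" unfolding inner_hardy_self by (rule infsum_nonneg) simp
  show "norm f = sqrt (inner f f)" by (rule norm_hardy_def)
  show "inner f f = 0 \<longleftrightarrow> f = 0"
  proof
    assume "inner f f = 0"
    then have "cmod (hcoef f \<alpha>) \<le> 0" for \<alpha>
      using hcoef_le[of f \<alpha>] by (simp add: norm_hardy_def)
    then show "f = 0" by (intro hardy_eqI) auto
  qed (simp add: inner_hardy_self)
qed

end

instance hardy :: (finite) complete_space
proof
  fix X :: "nat \<Rightarrow> 'a hardy"
  assume "Cauchy X"
  then have X: "\<exists>N. \<forall>m\<ge>N. \<forall>n\<ge>N. norm (X m - X n) < e" if "e > 0" for e
    using that unfolding Cauchy_def dist_norm by blast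
  have "Cauchy (\<lambda>n. hcoef (X n) \<alpha>)" for \<alpha>
  proof (rule metric_CauchyI)
    fix e :: real assume "e > 0"
    from X[OF this] obtain N where "\<forall>m\<ge>N. \<forall>n\<ge>N. norm (X m - X n) < e" by blast
    moreover have "dist (hcoef (X m) \<alpha>) (hcoef (X n) \<alpha>) \<le> norm (X m - X n)" for m n
      using hcoef_le[of "X m - X n" \<alpha>] by (simp add: hcoef_diff dist_norm)
    ultimately show "\<exists>N. \<forall>m\<ge>N. \<forall>n\<ge>N. dist (hcoef (X m) \<alpha>) (hcoef (X n) \<alpha>) < e"
      by (meson le_less_trans)
  qed
  then have "\<exists>l. (\<lambda>n. hcoef (X n) \<alpha>) \<longlonglongrightarrow> l" for \<alpha>
    by (simp add: Cauchy_convergent convergent_def[symmetric])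
  then obtain a where a: "\<And>\<alpha>. (\<lambda>n. hcoef (X n) \<alpha>) \<longlonglongrightarrow> a \<alpha>" by metis
  have tail: "(\<Sum>\<alpha>\<in>F. (cmod (hcoef (X m) \<alpha> - a \<alpha>))\<^sup>2) \<le> e\<^sup>2"
    if N: "\<forall>m\<ge>N. \<forall>n\<ge>N. norm (X m - X n) < e" and "m \<ge> N" "finite F" for N e m F
  proof (rule tendsto_upperbound)
    show "(\<lambda>n. \<Sum>\<alpha>\<in>F. (cmod (hcoef (X m) \<alpha> - hcoef (X n) \<alpha>))\<^sup>2)
        \<longlonglongrightarrow> (\<Sum>\<alpha>\<in>F. (cmod (hcoef (X m) \<alpha> - a \<alpha>))\<^sup>2)"
      by (intro tendsto_intros a)
    have "(\<Sum>\<alpha>\<in>F. (cmod (hcoef (X m) \<alpha> - hcoef (X n) \<alpha>))\<^sup>2) \<le> e\<^sup>2" if "n \<ge> N" for n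
    proof -
      have "norm (X m - X n) < e" using N that \<open>m \<ge> N\<close> by blast
      then have "(norm (X m - X n))\<^sup>2 \<le> e\<^sup>2"
        using hcoef_le[of "X m - X n"] order_trans[OF norm_ge_zero] by (intro power_mono) force+
      then show ?thesis
        using hcoef_sum_le[OF \<open>finite F\<close>, of "X m - X n"] by (simp add: hcoef_diff)
    qed
    then show "eventually (\<lambda>n. (\<Sum>\<alpha>\<in>F. (cmod (hcoef (X m) \<alpha> - hcoef (X n) \<alpha>))\<^sup>2) \<le> e\<^sup>2)
        sequentially"
      by (auto simp: eventually_sequentially)
  qed simp
  obtain N where N: "\<forall>m\<ge>N. \<forall>n\<ge>N. norm (X m - X n) < 1" using X[of 1] by auto
  have "(\<lambda>\<alpha>. hcoef (X N) \<alpha> - a \<alpha>) \<in> ell2"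
    unfolding ell2_def mem_Collect_eq
    by (rule nonneg_bdd_above_summable_on) (use tail[OF N] in \<open>auto intro!: bdd_aboveI2\<close>)
  from ell2_add[OF hcoef_ell2[of "X N"] ell2_cmult[OF this, of "-1"]]
  have "a \<in> ell2" by simp
  then have l: "hcoef (of_hcoef a) = a" by (rule hcoef_of_hcoef)
  have "X \<longlonglongrightarrow> of_hcoef a"
  proof (rule metric_LIMSEQ_I)
    fix e :: real assume e: "e > 0"
    then obtain N where "\<forall>m\<ge>N. \<forall>n\<ge>N. norm (X m - X n) < e/2" using X[of "e/2"] by auto
    then have "norm (X n - of_hcoef a) \<le> e/2" if "n \<ge> N" for n
      using tail[of N "e/2" n] that e by (intro norm_hardy_leI) (auto simp: hcoef_diff l)
    then show "\<exists>N. \<forall>n\<ge>N. dist (X n) (of_hcoef a) < e"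
      using e unfolding dist_norm by (intro exI[of _ N]) force
  qed
  then show "convergent X" by (auto simp: convergent_def)
qed

instantiation hardy :: (finite) chilbert_space
begin

definition scaleC_hardy :: "complex \<Rightarrow> 'a hardy \<Rightarrow> 'a hardy"
  where "c *\<^sub>C f = Abs_hardy (\<lambda>z. c * hardy_fun f z)"

definition cinner_hardy :: "'a hardy \<Rightarrow> 'a hardy \<Rightarrow> complex"
  where "cinner f g = (\<Sum>\<^sub>\<infinity>\<alpha>. hcoef f \<alpha> * cnj (hcoef g \<alpha>))"

lemma hcoef_scaleC: "hcoef (c *\<^sub>C f :: 'a hardy) = (\<lambda>\<alpha>. c * hcoef f \<alpha>)"
  unfolding scaleC_hardy_def
  by (rule hcoef_Abs)
    (auto simp: hardy_fun_outside intro: ell2_cmult hcoef_ell2 has_taylor_cmult has_taylor_hcoef)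

instance
proof
  fix f g h :: "'a hardy" and c d :: complex and r :: real
  show "c *\<^sub>C (f + g) = c *\<^sub>C f + c *\<^sub>C g" "(c + d) *\<^sub>C f = c *\<^sub>C f + d *\<^sub>C f"
    "c *\<^sub>C d *\<^sub>C f = (c * d) *\<^sub>C f" "complex_of_real r *\<^sub>C f = r *\<^sub>R f"
    by (rule hardy_eqI; simp add: hcoef_add hcoef_scaleC hcoef_scaleR algebra_simps)+
  show "cinner (f + g) h = cinner f h + cinner g h"
    by (simp add: cinner_hardy_def hcoef_add distrib_right infsum_add hcoef_mult_summable)
  show "cinner (c *\<^sub>C f) g = c * cinner f g"
    by (simp add: cinner_hardy_def hcoef_scaleC mult.assoc infsum_cmult_right')
  show "cinner g f = cnj (cinner f g)"
    unfolding cinner_hardy_def by (subst infsum_cnj[symmetric]) (simp add: mult.commute)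
  show "Re (cinner f g) = inner f g"
    by (simp add: cinner_hardy_def inner_hardy_def)
qed

end

text \<open>Multiplication by the coordinate function \<open>z i\<close>.\<close>

lift_definition shift :: "'k::finite \<Rightarrow> 'k hardy \<Rightarrow> 'k hardy"
  is "\<lambda>i f z. z $ i * f z"
proof -
  fix i :: 'k and f :: "complex ^ 'k \<Rightarrow> complex"
  assume "(\<exists>a\<in>ell2. has_taylor f a) \<and> (\<forall>z. z \<notin> polydisc \<longrightarrow> f z = 0)"
  then obtain a where a: "a \<in> ell2" "has_taylor f a" and f: "\<And>z. z \<notin> polydisc \<Longrightarrow> f z = 0"
    by blast
  define up :: "('k \<Rightarrow> nat) \<Rightarrow> 'k \<Rightarrow> nat" where "up \<alpha> = \<alpha>(i := Suc (\<alpha> i))" for \<alpha>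
  define down :: "('k \<Rightarrow> nat) \<Rightarrow> 'k \<Rightarrow> nat" where "down \<alpha> = \<alpha>(i := \<alpha> i - 1)" for \<alpha>
  define b where "b \<alpha> = (if \<alpha> i = 0 then 0 else a (down \<alpha>))" for \<alpha>
  have down_up: "down (up \<alpha>) = \<alpha>" for \<alpha> by (simp add: up_def down_def)
  have inj: "inj up" by (metis down_up injI)
  have b_up: "b (up \<alpha>) = a \<alpha>" for \<alpha>
    by (simp add: b_def down_up) (simp add: up_def)
  have b_out: "b \<alpha> = 0" if "\<alpha> \<notin> range up" for \<alpha>
  proof (rule ccontr)
    assume "b \<alpha> \<noteq> 0"
    then have "\<alpha> = up (down \<alpha>)" by (auto simp: b_def up_def down_def split: if_splits)
    then show False using that by blast
  qed
  have "b \<in> ell2"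
  proof -
    have "(\<lambda>\<alpha>. (cmod (b \<alpha>))\<^sup>2) summable_on range up"
      using a(1) by (simp add: summable_on_reindex[OF inj] o_def b_up ell2_def)
    then show ?thesis
      unfolding ell2_def mem_Collect_eq
      by (rule summable_on_cong_neutral[THEN iffD1, rotated -1]) (auto simp: b_out)
  qed
  moreover have "has_taylor (\<lambda>z. z $ i * f z) b"
    unfolding has_taylor_def
  proof
    fix z :: "complex ^ 'k" assume "z \<in> polydisc"
    then have "((\<lambda>\<alpha>. z $ i * (a \<alpha> * mpow z \<alpha>)) has_sum z $ i * f z) UNIV"
      using a(2) by (auto simp: has_taylor_def intro: has_sum_cmult_right)
    moreover have "z $ i * (a \<alpha> * mpow z \<alpha>) = b (up \<alpha>) * mpow z (up \<alpha>)" for \<alpha>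
    proof -
      have "mpow z \<beta> = (z $ i) ^ \<beta> i * (\<Prod>j\<in>UNIV - {i}. (z $ j) ^ \<beta> j)" for \<beta>
        unfolding mpow_def by (rule prod.remove) auto
      moreover have "(\<Prod>j\<in>UNIV - {i}. (z $ j) ^ up \<alpha> j) = (\<Prod>j\<in>UNIV - {i}. (z $ j) ^ \<alpha> j)"
        by (intro prod.cong) (auto simp: up_def)
      ultimately show ?thesis by (simp add: b_up) (simp add: up_def)
    qed
    ultimately have "((\<lambda>\<alpha>. b \<alpha> * mpow z \<alpha>) has_sum z $ i * f z) (range up)"
      by (simp add: has_sum_reindex[OF inj] o_def)
    then show "((\<lambda>\<alpha>. b \<alpha> * mpow z \<alpha>) has_sum z $ i * f z) UNIV"
      by (rule has_sum_cong_neutral[THEN iffD1, rotated -1]) (auto simp: b_out)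
  qed
  ultimately show "(\<exists>a\<in>ell2. has_taylor (\<lambda>z. z $ i * f z) a) \<and>
      (\<forall>z. z \<notin> polydisc \<longrightarrow> z $ i * f z = 0)"
    using f by auto
qed

end

theory Submission
  imports Defs
begin

text \<open>
  Gelfand's formula is replaced by an elementary estimate which shows that the norms
  \<open>\<parallel>C\<^sub>i\<^sup>n\<parallel>\<close> decay geometrically when the spectral radius is below 1.  Then
  \<open>h \<mapsto> \<Sum>\<alpha>. z\<^sup>\<alpha> \<otimes> C\<^sup>*\<^sup>\<alpha> h\<close> converges absolutely, is bounded below, and intertwines \<open>C\<^sub>i\<^sup>*\<close> with
  \<open>S\<^sub>i\<^sup>* \<otimes> I\<close>; its range is \<open>G\<close>.  The polynomial inequality needs no dilation: the vector
  \<open>[q(C)] v\<close> is \<open>\<Sum>\<alpha>. C\<^sup>\<alpha> q\<^sub>\<alpha> v\<close>, so by Cauchy-Schwarz its norm is at most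
  \<open>sqrt b\<close> times the square root of \<open>\<Sum>\<alpha>. \<parallel>q\<^sub>\<alpha> v\<parallel>\<^sup>2\<close>, and this sum is the mean of
  \<open>\<parallel>q(z) v\<parallel>\<^sup>2\<close> over a grid of roots of unity.
\<close>

section \<open>Adjoints\<close>

text \<open>The hypothesis concerns the spectrum only, so what it directly yields is, for each w in
  a disc separately, a lower bound for the norm of x - w T x in terms of that of x. Compactness of
  the disc makes the constant uniform; averaging over roots of unity then plays the part of the
  Cauchy integral for the coefficients of the resolvent, with finite sums in place of holomorphic
  operator functions. The constant b is the sum over all \<alpha> of the products of
  \<open>(onorm (C i ^^ \<alpha> i))\<^sup>2\<close>, rearranged as a product of k series; it
  dominates the sum of the squared norms of the monomials in C, which is what Cauchy-Schwarz asks
  for. A grid replaces the torus because a mean over roots of unity of order larger than every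
  exponent is already exact for the polynomials at hand. Adjoints and A tensor I are definite
  descriptions, so nothing can be computed with them before existence and uniqueness are known; this
  is why Riesz representation and a closed graph enter.\<close>

instance chilbert_space \<subseteq> banach ..

section \<open>Algebra of the complex inner product and its norm\<close>

lemma cinner_add_right: "cinner x (y + z) = cinner x y + cinner x z"
  for x :: "'a::chilbert_space"
  by (subst (1 2 3) cinner_commute) (simp add: cinner_add_left)

lemma cinner_scaleC_right: "cinner x (c *\<^sub>C y) = cnj c * cinner x y"
  for x :: "'a::chilbert_space"
  by (subst (1 2) cinner_commute) (simp add: cinner_scaleC_left)

lemma Im_cinner: "Im (cinner x y) = - inner (\<i> *\<^sub>C x) y"
  by (simp add: Re_cinner[symmetric] cinner_scaleC_left)

lemma cinner_self: "cinner x x = of_real ((norm x)\<^sup>2)" for x :: "'a::chilbert_space"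
proof (rule complex_eqI)
  show "Re (cinner x x) = Re (of_real ((norm x)\<^sup>2))"
    by (simp add: Re_cinner power2_norm_eq_inner)
  have "Im (cinner x x) = - Im (cinner x x)"
    by (subst cinner_commute) simp
  then show "Im (cinner x x) = Im (of_real ((norm x)\<^sup>2))" by simp
qed

lemma cinner_zero_left [simp]: "cinner 0 y = 0"
  using cinner_add_left[of 0 0 y] by simp

lemma cinner_zero_right [simp]: "cinner x 0 = 0"
  using cinner_add_right[of x 0 0] by simp

lemma cinner_sum_left: "cinner (sum f A) y = (\<Sum>i\<in>A. cinner (f i) y)"
  by (induction A rule: infinite_finite_induct) (simp_all add: cinner_add_left)

lemma cinner_sum_right: "cinner x (sum f A) = (\<Sum>i\<in>A. cinner x (f i))"
  by (induction A rule: infinite_finite_induct) (simp_all add: cinner_add_right)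

lemma cinner_diff_left: "cinner (x - y) z = cinner x z - cinner y z"
  using cinner_add_left[of "x - y" y z] by (simp add: algebra_simps)

lemma cinner_ext:
  assumes "\<And>z. cinner z x = cinner z y"
  shows "x = y"
proof -
  have "inner z x = inner z y" for z using assms[of z] Re_cinner by metis
  then show ?thesis by (simp add: vector_eq_ldot[of x y, symmetric] inner_commute)
qed

lemma norm_scaleC: "norm (c *\<^sub>C x) = cmod c * norm (x :: 'a::chilbert_space)"
proof -
  have "complex_of_real ((norm (c *\<^sub>C x))\<^sup>2) = complex_of_real ((cmod c * norm x)\<^sup>2)"
    unfolding cinner_self[symmetric] cinner_scaleC_left cinner_scaleC_right
    by (simp add: cinner_self complex_norm_square[symmetric] power_mult_distrib mult_ac)
  then have "(norm (c *\<^sub>C x))\<^sup>2 = (cmod c * norm x)\<^sup>2" by (simp only: of_real_eq_iff)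
  then show ?thesis by simp
qed

lemma bounded_clinear_linear: "bounded_clinear T \<Longrightarrow> bounded_linear T"
  and bounded_clinear_scaleC: "bounded_clinear T \<Longrightarrow> T (c *\<^sub>C x) = c *\<^sub>C T x"
  by (auto simp: bounded_clinear_def)

lemma bounded_clinear_norm_le:
  "bounded_clinear T \<Longrightarrow> norm (T x) \<le> onorm T * norm x"
  by (rule onorm) (rule bounded_clinear_linear)

lemma bounded_clinear_id: "bounded_clinear id"
  unfolding bounded_clinear_def using bounded_linear_ident by (simp add: id_def)

lemma bounded_clinear_compose:
  "bounded_clinear S \<Longrightarrow> bounded_clinear T \<Longrightarrow> bounded_clinear (S \<circ> T)"
  unfolding bounded_clinear_def using bounded_linear_compose[of S T] by (auto simp: o_def)

lemma bounded_clinear_funpow: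
  fixes T :: "'a::chilbert_space \<Rightarrow> 'a"
  shows "bounded_clinear T \<Longrightarrow> bounded_clinear (T ^^ n)"
  by (induction n) (simp_all add: bounded_clinear_id bounded_clinear_compose)

lemma bounded_clinearI:
  assumes "\<And>x y. T (x + y) = T x + T y" "\<And>c x. T (c *\<^sub>C x) = c *\<^sub>C T x"
    "\<And>x. norm (T x) \<le> K * norm x"
  shows "bounded_clinear T"
  unfolding bounded_clinear_def
proof (intro conjI allI)
  show "bounded_linear T"
  proof (rule bounded_linear_intro)
    show "T (r *\<^sub>R x) = r *\<^sub>R T x" for r x
      using assms(2)[of "of_real r" x] by (simp add: scaleC_of_real)
    show "norm (T x) \<le> norm x * K" for x using assms(3)[of x] by (simp add: mult.commute)
  qed (rule assms)
qed (rule assms)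

text \<open>The representing vector is the minimizer of \<open>\<lambda>x. (norm x)\<^sup>2 / 2 - f x\<close>, along which the
  parallelogram law makes every minimizing sequence Cauchy.\<close>

lemma riesz_representation:
  fixes f :: "'a::{real_inner,complete_space} \<Rightarrow> real"
  assumes "bounded_linear f"
  shows "\<exists>y. \<forall>x. f x = inner x y"
proof -
  interpret f: bounded_linear f by fact
  define J where "J x = (norm x)\<^sup>2 / 2 - f x" for x
  have low: "- (onorm f)\<^sup>2 / 2 \<le> J x" for x
  proof -
    have "f x \<le> onorm f * norm x" using onorm[OF assms, of x] by simp
    moreover have "2 * (onorm f * norm x) \<le> (onorm f)\<^sup>2 + (norm x)\<^sup>2"
      using sum_squares_bound[of "onorm f" "norm x"] by simp
    ultimately show ?thesis by (simp add: J_def)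
  qed
  define d where "d = Inf (range J)"
  have bdd: "bdd_below (range J)" using low by (intro bdd_belowI2)
  have d_le: "d \<le> J x" for x unfolding d_def by (intro cINF_lower bdd) simp
  have par: "(norm (x - y))\<^sup>2 \<le> 4 * (J x + J y - 2 * d)" for x y
  proof -
    have "J x + J y - 2 * J ((1/2) *\<^sub>R (x + y)) = (norm (x - y))\<^sup>2 / 4"
      by (simp add: J_def f.scaleR f.add power2_norm_eq_inner inner_diff inner_add
          inner_commute[of y x] power_mult_distrib field_simps)
    then show ?thesis using d_le[of "(1/2) *\<^sub>R (x + y)"] by simp
  qed
  have "\<exists>x. J x < d + 1 / real (Suc n)" for n
    using cINF_less_iff[OF _ bdd, of "d + 1 / real (Suc n)"] by (simp add: d_def)
  then obtain X where X: "\<And>n. J (X n) < d + 1 / real (Suc n)" by metis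
  have "Cauchy X"
  proof (rule metric_CauchyI)
    fix e :: real assume e: "e > 0"
    obtain N where N: "1 / real (Suc N) < e\<^sup>2 / 8"
      using nat_approx_posE[of "e\<^sup>2 / 8"] e by auto
    have "dist (X m) (X n) < e" if "m \<ge> N" "n \<ge> N" for m n
    proof -
      have "1 / real (Suc k) \<le> 1 / real (Suc N)" if "k \<ge> N" for k
        using that by (intro divide_left_mono) auto
      then have "J (X m) < d + e\<^sup>2 / 8" "J (X n) < d + e\<^sup>2 / 8"
        using X[of m] X[of n] N that by (smt (verit))+
      with par[of "X m" "X n"] have "(norm (X m - X n))\<^sup>2 < e\<^sup>2" by argo
      then show ?thesis using e by (auto simp: dist_norm intro: power2_less_imp_less)
    qed
    then show "\<exists>N. \<forall>m\<ge>N. \<forall>n\<ge>N. dist (X m) (X n) < e" by blast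
  qed
  then obtain y where y: "X \<longlonglongrightarrow> y" using Cauchy_convergent convergent_def by blast
  have "(\<lambda>n. J (X n)) \<longlonglongrightarrow> J y"
    unfolding J_def by (intro tendsto_intros y f.tendsto) simp
  moreover have "(\<lambda>n. d + 1 / real (Suc n)) \<longlonglongrightarrow> d + 0"
    by (intro tendsto_intros LIMSEQ_Suc lim_1_over_n)
  ultimately have "J y \<le> d"
    using X by (intro LIMSEQ_le[of "\<lambda>n. J (X n)" "J y"]) (auto intro: less_imp_le)
  then have min: "J y \<le> J z" for z using d_le[of z] by simp
  have "f x = inner x y" for x
  proof (rule ccontr)
    define s where "s = f x - inner x y"
    assume "f x \<noteq> inner x y"
    then have s: "s \<noteq> 0" by (simp add: s_def)
    \<comment> \<open>Moving from \<open>y\<close> by \<open>c * s\<close> times \<open>x\<close>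
      changes \<open>J\<close> by \<open>c * s\<^sup>2 * (c * (norm x)\<^sup>2 / 2 - 1)\<close>, so
      any small enough positive \<open>c\<close> contradicts minimality. The summand 1 in the
      denominator covers \<open>x = 0\<close>.\<close>
    define c where "c = 1 / ((norm x)\<^sup>2 + 1)"
    have "(norm x)\<^sup>2 + 1 > 0" by (simp add: add_nonneg_pos)
    then have c: "c > 0" "c * (norm x)\<^sup>2 < 1" by (simp_all add: c_def divide_less_eq)
    have "J (y + t *\<^sub>R x) - J y = t\<^sup>2 * (norm x)\<^sup>2 / 2 - t * s" for t
      unfolding J_def power2_norm_eq_inner f.scaleR f.add s_def
      by (simp add: inner_add inner_commute[of y x] power2_eq_square algebra_simps)
    from this[of "c * s"]
    have "J (y + (c * s) *\<^sub>R x) - J y = (c * s)\<^sup>2 * (norm x)\<^sup>2 / 2 - c * s * s" .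
    also have "\<dots> = c * s\<^sup>2 * (c * (norm x)\<^sup>2 / 2 - 1)"
      by (simp add: power2_eq_square algebra_simps)
    also have "\<dots> < 0" using c s by (intro mult_pos_neg mult_pos_pos) simp_all
    finally show False using min[of "y + (c * s) *\<^sub>R x"] by linarith
  qed
  then show ?thesis by blast
qed

text \<open>Riesz represents the real part of \<open>cinner (T x) y\<close> as a functional of
  \<open>x\<close>. Evaluating the real identity also at \<open>\<i> *\<^sub>C x\<close> recovers
  the imaginary part, since \<open>T\<close> is complex linear.\<close>

lemma adj_ex:
  fixes T :: "'a::chilbert_space \<Rightarrow> 'b::chilbert_space"
  assumes "bounded_clinear T"
  shows "\<exists>!T'. \<forall>x y. cinner (T x) y = cinner x (T' y)"
proof -
  interpret T: bounded_linear T using assms by (rule bounded_clinear_linear)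
  have "\<exists>y'. \<forall>x. cinner (T x) y = cinner x y'" for y
  proof -
    have "bounded_linear (\<lambda>x. inner (T x) y)"
      by (intro bounded_linear_compose[OF bounded_linear_inner_left] T.bounded_linear)
    from riesz_representation[OF this] obtain y' where y': "\<And>x. inner (T x) y = inner x y'"
      by blast
    have "cinner (T x) y = cinner x y'" for x
      using y'[of x] y'[of "\<i> *\<^sub>C x"]
      by (intro complex_eqI) (simp_all add: Re_cinner Im_cinner bounded_clinear_scaleC[OF assms])
    then show ?thesis by blast
  qed
  then obtain T' where "\<forall>x y. cinner (T x) y = cinner x (T' y)" by metis
  moreover have "S = S'" if "\<forall>x y. cinner (T x) y = cinner x (S y)"
      "\<forall>x y. cinner (T x) y = cinner x (S' y)" for S S'
    by (rule ext, rule cinner_ext) (use that in metis)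
  ultimately show ?thesis by (intro ex_ex1I) (rule exI)
qed

lemma cinner_adj:
  assumes "bounded_clinear T"
  shows "cinner (T x) y = cinner x (adj T y)"
  using theI'[OF adj_ex[OF assms]] unfolding adj_def by blast

lemma adj_eqI:
  assumes "bounded_clinear T" "\<And>x. cinner (T x) y = cinner x y'"
  shows "adj T y = y'"
  by (rule cinner_ext) (simp add: assms(2) cinner_adj[OF assms(1), symmetric])

text \<open>Testing the adjoint relation on \<open>adj T y\<close> itself bounds the square of its
  norm by a multiple of its norm. Linearity of \<open>adj T\<close> does not enter, so the bound can
  serve in the proof of \<open>bounded_clinear_adj\<close>.\<close>

lemma norm_adj_le:
  assumes "bounded_clinear T"
  shows "norm (adj T y) \<le> onorm T * norm y"
proof -
  have "(norm (adj T y))\<^sup>2 = inner (T (adj T y)) y"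
    by (simp add: power2_norm_eq_inner Re_cinner[symmetric] cinner_adj[OF assms])
  also have "\<dots> \<le> norm (T (adj T y)) * norm y" by (rule norm_cauchy_schwarz)
  also have "\<dots> \<le> onorm T * norm (adj T y) * norm y"
    by (intro mult_right_mono bounded_clinear_norm_le assms) simp
  finally have "norm (adj T y) * norm (adj T y) \<le> norm (adj T y) * (onorm T * norm y)"
    by (simp add: power2_eq_square mult_ac)
  then show ?thesis
    using onorm_pos_le[OF bounded_clinear_linear[OF assms]]
    by (cases "adj T y = 0") auto
qed

lemma bounded_clinear_adj:
  assumes "bounded_clinear T"
  shows "bounded_clinear (adj T)"
proof (rule bounded_clinearI)
  show "adj T (x + y) = adj T x + adj T y" for x y
    by (rule adj_eqI) (simp_all add: assms cinner_add_right cinner_adj)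
  show "adj T (c *\<^sub>C x) = c *\<^sub>C adj T x" for c x
    by (rule adj_eqI) (simp_all add: assms cinner_scaleC_right cinner_adj)
qed (rule norm_adj_le[OF assms])

lemma adj_compose:
  assumes "bounded_clinear S" "bounded_clinear T"
  shows "adj (S \<circ> T) = adj T \<circ> adj S"
  by (rule ext, rule adj_eqI) (simp_all add: assms bounded_clinear_compose cinner_adj)

text \<open>Carries norm bounds for powers of \<open>C i\<close> over to powers of its adjoint. That
  adjoints reverse composites is harmless here, because the powers of one operator commute.\<close>

lemma adj_funpow:
  fixes T :: "'a::chilbert_space \<Rightarrow> 'a"
  assumes "bounded_clinear T"
  shows "adj (T ^^ n) = adj T ^^ n"
proof (induction n)
  case 0
  then show ?case by (intro ext, rule adj_eqI) (simp_all add: bounded_clinear_id[unfolded id_def] id_def)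
next
  case (Suc n)
  have "adj (T ^^ Suc n) = adj (T ^^ n) \<circ> adj T"
    unfolding funpow.simps by (rule adj_compose) (simp_all add: assms bounded_clinear_funpow)
  then show ?case by (simp only: Suc funpow_Suc_right)
qed

section \<open>Powers of operators of spectral radius less than 1\<close>

lemma root_of_unity_prim:
  assumes "N > 0"
  defines "w \<equiv> cis (2 * pi / real N)"
  shows "w ^ N = 1" "cmod w = 1" "w * cnj w = 1" "\<And>m. 0 < m \<Longrightarrow> m < N \<Longrightarrow> w ^ m \<noteq> 1"
proof -
  show "w ^ N = 1" unfolding w_def Complex.DeMoivre using assms by simp
  show "cmod w = 1" by (simp add: w_def)
  show "w * cnj w = 1" by (simp add: w_def cis_cnj cis_mult)
  fix m assume m: "0 < m" "m < N"
  have inj: "inj_on (\<lambda>k. cis (2 * pi * real k / real N)) {..<N}"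
    using Complex.bij_betw_roots_unity[OF assms(1)] by (rule bij_betw_imp_inj_on)
  show "w ^ m \<noteq> 1"
  proof
    assume "w ^ m = 1"
    then have "cis (2 * pi * real m / real N) = cis (2 * pi * real 0 / real N)"
      by (simp add: w_def Complex.DeMoivre mult_ac)
    from inj_onD[OF inj this] m show False by simp
  qed
qed

lemma sum_powers_root:
  fixes z :: complex
  assumes "z ^ N = 1"
  shows "(\<Sum>g<N. z ^ g) = (if z = 1 then of_nat N else 0)"
  using assms sum_gp_strict[of z N] by auto

text \<open>A truncated Neumann series for the inverse of I - u A; the truncation keeps all
  identities within finite sums.\<close>

definition geom_op :: "('a::chilbert_space \<Rightarrow> 'a) \<Rightarrow> nat \<Rightarrow> complex \<Rightarrow> 'a \<Rightarrow> 'a"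
  where "geom_op A N u x = (\<Sum>j<N. u ^ j *\<^sub>C (A ^^ j) x)"

lemma bounded_clinear_sum:
  assumes "bounded_clinear T"
  shows "T (sum f I) = (\<Sum>i\<in>I. T (f i))"
proof -
  interpret T: bounded_linear T using assms by (rule bounded_clinear_linear)
  show ?thesis by (rule T.sum)
qed

lemma bounded_clinear_diff: "bounded_clinear T \<Longrightarrow> T (x - y) = T x - T y"
  using bounded_linear.linear[OF bounded_clinear_linear] by (rule linear_diff)

lemma geom_op_commute:
  assumes "bounded_clinear A"
  shows "A (geom_op A N u x) = geom_op A N u (A x)"
  by (simp add: geom_op_def bounded_clinear_sum[OF assms] bounded_clinear_scaleC[OF assms] funpow_swap1)

lemma geom_op_funpow:
  assumes "bounded_clinear A"
  shows "(A ^^ n) (geom_op A N u x) = geom_op A N u ((A ^^ n) x)"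
  by (induction n) (simp_all add: geom_op_commute[OF assms])

lemma geom_op_diff:
  assumes "bounded_clinear A"
  shows "geom_op A N u (x - y) = geom_op A N u x - geom_op A N u y"
  by (simp add: geom_op_def bounded_clinear_diff[OF bounded_clinear_funpow[OF assms]]
      complex_vector.scale_right_diff_distrib sum_subtractf)

text \<open>For an N-th root of unity \<open>u\<close> the remainder does not depend on
  \<open>u\<close>, so one bound serves all the roots.\<close>

lemma geom_op_telescope:
  assumes "bounded_clinear A" "u ^ N = 1"
  shows "geom_op A N u x - u *\<^sub>C A (geom_op A N u x) = x - (A ^^ N) x"
proof -
  have "u *\<^sub>C A (geom_op A N u x) = (\<Sum>j<N. u ^ Suc j *\<^sub>C (A ^^ Suc j) x)"
    by (simp add: geom_op_def bounded_clinear_sum[OF assms(1)] bounded_clinear_scaleC[OF assms(1)]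
        complex_vector.scale_sum_right)
  then have "geom_op A N u x - u *\<^sub>C A (geom_op A N u x) =
      (\<Sum>j<N. u ^ j *\<^sub>C (A ^^ j) x - u ^ Suc j *\<^sub>C (A ^^ Suc j) x)"
    by (simp only: geom_op_def sum_subtractf)
  also have "\<dots> = u ^ 0 *\<^sub>C (A ^^ 0) x - u ^ N *\<^sub>C (A ^^ N) x"
    by (rule sum_lessThan_telescope')
  finally show ?thesis using assms(2) by simp
qed

text \<open>In u G(u)^2 the power A^(j+l) carries u^(1+j+l), and summing over the roots keeps only
  exponents divisible by N. As 1 + j + l lies between 1 and 2N - 1, it must equal N, which leaves N
  pairs (j, l). The square is essential: u G(u) alone would produce A^(N-1) only once, and the
  resulting bound would not decay in N.\<close>

lemma sum_roots_geom_op_square: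
  assumes A: "bounded_clinear A" and N: "N > 0"
  defines "w \<equiv> cis (2 * pi / real N)"
  shows "(\<Sum>g<N. w ^ g *\<^sub>C geom_op A N (w ^ g) (geom_op A N (w ^ g) x)) =
    of_nat (N * N) *\<^sub>C (A ^^ (N - 1)) x"
proof -
  note w = root_of_unity_prim[OF N, folded w_def]
  have root: "(\<Sum>g<N. (w ^ (1 + j + l)) ^ g) = (if l = N - 1 - j then of_nat N else 0)"
    if "j < N" "l < N" for j l
  proof -
    have "w ^ (1 + j + l) = 1 \<longleftrightarrow> l = N - 1 - j"
    proof (cases "1 + j + l" N rule: linorder_cases)
      case less
      then show ?thesis using w(4)[of "1 + j + l"] by auto
    next
      case equal
      then show ?thesis using w(1) by auto
    next
      case greater
      then have "w ^ (1 + j + l) = w ^ (1 + j + l - N)"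
        using w(1) by (metis less_imp_le mult_1 power_add le_add_diff_inverse)
      moreover have "w ^ (1 + j + l - N) \<noteq> 1" using that greater by (intro w(4)) auto
      moreover have "l \<noteq> N - 1 - j" using greater that by linarith
      ultimately show ?thesis by metis
    qed
    moreover have "(w ^ (1 + j + l)) ^ N = 1"
      by (metis w(1) mult.commute power_mult power_one)
    ultimately show ?thesis by (simp only: sum_powers_root)
  qed
  have "(\<Sum>g<N. w ^ g *\<^sub>C geom_op A N (w ^ g) (geom_op A N (w ^ g) x)) =
      (\<Sum>g<N. \<Sum>j<N. \<Sum>l<N. (w ^ (1 + j + l)) ^ g *\<^sub>C (A ^^ (j + l)) x)"
    unfolding geom_op_def bounded_clinear_sum[OF bounded_clinear_funpow[OF A]]
      bounded_clinear_scaleC[OF bounded_clinear_funpow[OF A]] complex_vector.scale_sum_right scaleC_scaleC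
    by (intro sum.cong refl arg_cong2[of _ _ _ _ scaleC])
      (simp_all add: funpow_add power_mult[symmetric] power_add[symmetric] algebra_simps)
  also have "\<dots> = (\<Sum>j<N. \<Sum>l<N. (\<Sum>g<N. (w ^ (1 + j + l)) ^ g) *\<^sub>C (A ^^ (j + l)) x)"
    unfolding complex_vector.scale_sum_left
    by (subst sum.swap, rule sum.cong[OF refl], rule sum.swap)
  also have "\<dots> = (\<Sum>j<N. \<Sum>l<N. if l = N - 1 - j then of_nat N *\<^sub>C (A ^^ (j + l)) x else 0)"
    by (intro sum.cong refl) (simp only: root lessThan_iff, simp)
  also have "\<dots> = (\<Sum>j<N. of_nat N *\<^sub>C (A ^^ (N - 1)) x)"
    by (intro sum.cong refl) auto
  also have "\<dots> = of_nat (N * N) *\<^sub>C (A ^^ (N - 1)) x"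
    by (simp add: sum_constant_scaleR scaleC_of_real[symmetric] scaleC_scaleC)
  finally show ?thesis .
qed

text \<open>With \<open>G u = \<Sum>j<N. u ^ j * A ^ j\<close>, the average of \<open>u * (G u)\<^sup>2\<close> over the \<open>N\<close>-th roots of
  unity \<open>u\<close> is \<open>N * A ^ (N - 1)\<close>, while \<open>(1 - u * A) * G u = 1 - A ^ N\<close> and the lower bound
  control each \<open>G u\<close>.\<close>

lemma power_bound_of_lower_bound:
  assumes A: "bounded_clinear A" and K: "K \<ge> 0" and N: "N > 0"
    and low: "\<And>u x. cmod u = 1 \<Longrightarrow> norm x \<le> K * norm (x - u *\<^sub>C A x)"
    and one: "\<And>x. norm ((A ^^ N) x) \<le> norm x"
  shows "real N * norm ((A ^^ (N - 1)) x) \<le> 4 * K\<^sup>2 * norm x"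
proof -
  define w where "w = cis (2 * pi / real N)"
  note w = root_of_unity_prim[OF N, folded w_def]
  have step: "norm (x - (A ^^ N) x) \<le> 2 * norm x" for x
    using norm_triangle_ineq4[of x "(A ^^ N) x"] one[of x] by simp
  have B: "norm (geom_op A N u x) \<le> K * norm (x - (A ^^ N) x)" if "u ^ N = 1" "cmod u = 1" for u x
    using low[OF that(2), of "geom_op A N u x"] geom_op_telescope[OF A that(1), of x] by simp
  have BB: "norm (w ^ g *\<^sub>C geom_op A N (w ^ g) (geom_op A N (w ^ g) x)) \<le> 4 * K\<^sup>2 * norm x" for g
  proof -
    define u where "u = w ^ g"
    have u: "u ^ N = 1" "cmod u = 1"
      by (metis u_def w(1) mult.commute power_mult power_one) (simp add: u_def norm_power w(2))
    define z where "z = x - (A ^^ N) x"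
    \<comment> \<open>By \<open>B\<close>, one application of \<open>geom_op A N u\<close> costs a
      factor \<open>K\<close> and an application of I - A^N. These operators commute, so doing it
      twice moves both differences onto \<open>x\<close>, where each costs a factor 2.\<close>
    have "norm (geom_op A N u (geom_op A N u x)) \<le>
        K * norm (geom_op A N u x - (A ^^ N) (geom_op A N u x))"
      by (rule B[OF u])
    also have "geom_op A N u x - (A ^^ N) (geom_op A N u x) = geom_op A N u z"
      by (simp add: z_def geom_op_funpow[OF A] geom_op_diff[OF A])
    also have "norm (geom_op A N u z) \<le> K * (2 * (2 * norm x))"
      using B[OF u, of z] mult_left_mono[OF order_trans[OF step[of z] mult_left_mono[OF step[of x, folded z_def]]] K]
      by simp
    finally have "norm (geom_op A N u (geom_op A N u x)) \<le> K * (K * (2 * (2 * norm x)))"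
      using K by (simp add: mult_left_mono)
    then show ?thesis unfolding u_def[symmetric] norm_scaleC u(2) by (simp add: power2_eq_square mult_ac)
  qed
  have "real (N * N) * norm ((A ^^ (N - 1)) x) =
      norm (\<Sum>g<N. w ^ g *\<^sub>C geom_op A N (w ^ g) (geom_op A N (w ^ g) x))"
    unfolding w_def sum_roots_geom_op_square[OF A N] norm_scaleC norm_of_nat by (rule refl)
  also have "\<dots> \<le> (\<Sum>g<N. 4 * K\<^sup>2 * norm x)" by (rule sum_norm_le) (rule BB)
  also have "\<dots> = real N * (4 * K\<^sup>2 * norm x)" by simp
  finally show ?thesis using N by (simp add: mult.assoc)
qed

text \<open>The bound at \<open>w\<close> survives nearby with twice the constant: the perturbation
  contributes at most half of \<open>norm x\<close>, which is absorbed on the left. Finitely many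
  such discs cover the compact parameter disc.\<close>

lemma lower_bound_uniform:
  fixes T :: "'a::chilbert_space \<Rightarrow> 'a"
  assumes T: "bounded_clinear T"
    and low: "\<And>w. cmod w \<le> R \<Longrightarrow> \<exists>K. \<forall>x. norm x \<le> K * norm (x - w *\<^sub>C T x)"
  shows "\<exists>K\<ge>0. \<forall>w x. cmod w \<le> R \<longrightarrow> norm x \<le> K * norm (x - w *\<^sub>C T x)"
proof -
  have "\<forall>w. \<exists>K>0. cmod w \<le> R \<longrightarrow> (\<forall>x. norm x \<le> K * norm (x - w *\<^sub>C T x))"
  proof
    fix w
    show "\<exists>K>0. cmod w \<le> R \<longrightarrow> (\<forall>x. norm x \<le> K * norm (x - w *\<^sub>C T x))"
    proof (cases "cmod w \<le> R")
      case True
      then obtain K where K: "\<And>x. norm x \<le> K * norm (x - w *\<^sub>C T x)" using low by blast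
      have "norm x \<le> max 1 K * norm (x - w *\<^sub>C T x)" for x
        by (rule order_trans[OF K]) (simp add: mult_right_mono)
      then show ?thesis by (intro exI[of _ "max 1 K"]) auto
    qed (auto intro: exI[of _ 1])
  qed
  then obtain K where Kpos: "\<And>w. K w > 0"
    and K: "\<And>w x. cmod w \<le> R \<Longrightarrow> norm x \<le> K w * norm (x - w *\<^sub>C T x)" by metis
  \<comment> \<open>Adding 1 makes \<open>t\<close> positive even for \<open>T = 0\<close>, so that
    the radii in \<open>U\<close> are genuine.\<close>
  define t where "t = onorm T + 1"
  have t: "t > 0" using onorm_pos_le[OF bounded_clinear_linear[OF T]] by (simp add: t_def)
  define U where "U w = ball w (1 / (2 * K w * t))" for w
  have near: "norm x \<le> 2 * K w * norm (x - v *\<^sub>C T x)" if "cmod w \<le> R" "v \<in> U w" for v w x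
  proof -
    have "norm x \<le> K w * norm (x - w *\<^sub>C T x)" using K that by blast
    also have "x - w *\<^sub>C T x = (x - v *\<^sub>C T x) + (v - w) *\<^sub>C T x"
      by (simp add: complex_vector.scale_left_diff_distrib)
    also have "norm \<dots> \<le> norm (x - v *\<^sub>C T x) + norm ((v - w) *\<^sub>C T x)" by (rule norm_triangle_ineq)
    also have "norm ((v - w) *\<^sub>C T x) \<le> 1 / (2 * K w * t) * (t * norm x)"
      unfolding norm_scaleC
    proof (intro mult_mono)
      show "cmod (v - w) \<le> 1 / (2 * K w * t)"
        using that(2) by (simp add: U_def dist_norm norm_minus_commute)
      show "norm (T x) \<le> t * norm x"
        using bounded_clinear_norm_le[OF T, of x] norm_ge_zero[of x]
        by (simp add: t_def distrib_right del: norm_ge_zero)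
    qed (use Kpos[of w] t in auto)
    also have "K w * (norm (x - v *\<^sub>C T x) + 1 / (2 * K w * t) * (t * norm x)) =
        K w * norm (x - v *\<^sub>C T x) + norm x / 2"
      using Kpos[of w] t by (simp add: field_simps)
    finally show ?thesis using Kpos[of w] by (simp add: mult_left_mono)
  qed
  have "compact (cball (0::complex) R)" by simp
  moreover have "open (U w)" for w by (simp add: U_def)
  moreover have "cball 0 R \<subseteq> (\<Union>w\<in>cball 0 R. U w)"
    using Kpos t by (auto simp: U_def intro!: bexI)
  ultimately obtain W where W: "W \<subseteq> cball 0 R" "finite W" "cball 0 R \<subseteq> (\<Union>w\<in>W. U w)"
    by (metis compactE_image)
  \<comment> \<open>The sum dominates every single \<open>2 * K w\<close> and is nonnegative even
    when \<open>W\<close> is empty.\<close>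
  define M where "M = (\<Sum>w\<in>W. 2 * K w)"
  have "norm x \<le> M * norm (x - v *\<^sub>C T x)" if "cmod v \<le> R" for v x
  proof -
    from that W obtain w where w: "w \<in> W" "v \<in> U w" by force
    have "norm x \<le> 2 * K w * norm (x - v *\<^sub>C T x)" using near w W by auto
    also have "2 * K w \<le> M"
      unfolding M_def using W(2) w(1) Kpos by (intro member_le_sum) (auto simp: less_imp_le)
    finally show ?thesis by (simp add: mult_right_mono)
  qed
  moreover have "M \<ge> 0" unfolding M_def using Kpos by (intro sum_nonneg) (auto simp: less_imp_le)
  ultimately show ?thesis by blast
qed


lemma funpow_scaleC:
  fixes T :: "'a::chilbert_space \<Rightarrow> 'a"
  assumes "bounded_clinear T"
  shows "((\<lambda>x. c *\<^sub>C T x) ^^ n) x = c ^ n *\<^sub>C (T ^^ n) x"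
  by (induction n) (simp_all add: bounded_clinear_scaleC[OF assms] scaleC_one scaleC_scaleC)

lemma bounded_clinear_scaleC_op:
  assumes "bounded_clinear T"
  shows "bounded_clinear (\<lambda>x. c *\<^sub>C T x)"
proof (rule bounded_clinearI)
  show "norm (c *\<^sub>C T x) \<le> cmod c * onorm T * norm x" for x
    using bounded_clinear_norm_le[OF assms, of x]
    by (simp add: norm_scaleC mult.assoc mult_left_mono)
qed (simp_all add: bounded_clinear_scaleC[OF assms] scaleC_add_right scaleC_scaleC mult.commute
    linear_add[OF bounded_linear.linear[OF bounded_clinear_linear[OF assms]]])

text \<open>If \<open>\<rho> ^ n * onorm (T ^^ n)\<close> took the value 1 for some \<open>\<rho> \<le> R\<close>, then
  \<open>power_bound_of_lower_bound\<close> would bound it by a multiple of \<open>1 / n\<close>.  So for large \<open>n\<close> it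
  stays below 1 on all of \<open>[0, R]\<close>, by the intermediate value theorem.\<close>

lemma power_lt_one_of_lower_bounds:
  fixes T :: "'a::chilbert_space \<Rightarrow> 'a"
  assumes T: "bounded_clinear T" and R: "R \<ge> 0"
    and low: "\<And>w. cmod w \<le> R \<Longrightarrow> \<exists>K. \<forall>x. norm x \<le> K * norm (x - w *\<^sub>C T x)"
  shows "\<exists>N. \<forall>n\<ge>N. R ^ n * onorm (T ^^ n) < 1"
proof -
  obtain K where K: "K \<ge> 0"
    and lowK: "\<And>w x. cmod w \<le> R \<Longrightarrow> norm x \<le> K * norm (x - w *\<^sub>C T x)"
    using lower_bound_uniform[OF T low] by blast
  obtain N where N: "R * onorm T * (4 * K\<^sup>2) < real N" using reals_Archimedean2 by blast
  have Tpos: "onorm T \<ge> 0" by (rule onorm_pos_le[OF bounded_clinear_linear[OF T]])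
  have "R ^ n * onorm (T ^^ n) < 1" if "n \<ge> Suc N" for n
  proof (rule ccontr)
    let ?f = "\<lambda>r. r ^ n * onorm (T ^^ n)"
    assume "\<not> ?thesis"
    then have "1 \<le> ?f R" by simp
    moreover have "?f 0 \<le> 1" using that by (simp add: power_0_left)
    moreover have "continuous_on {0..R} ?f" by (intro continuous_intros)
    ultimately obtain r where r: "0 \<le> r" "r \<le> R" "?f r = 1"
      using IVT'[of ?f 0 1 R] R by auto
    then have rpos: "r > 0" using that by (cases "r = 0") (auto simp: power_0_left)
    \<comment> \<open>By the choice of \<open>r\<close> the rescaled operator satisfies
      \<open>norm ((A ^^ n) x) \<le> norm x\<close>, and for \<open>cmod u = 1\<close> the parameter
      \<open>u * r\<close> stays in the disc where \<open>K\<close> is valid.\<close>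
    define A where "A x = complex_of_real r *\<^sub>C T x" for x
    have A: "bounded_clinear A" unfolding A_def by (rule bounded_clinear_scaleC_op[OF T])
    have Apow: "norm ((A ^^ m) x) = r ^ m * norm ((T ^^ m) x)" for m x
      using r by (simp add: A_def[abs_def] funpow_scaleC[OF T] norm_scaleC norm_power)
    have lowA: "norm x \<le> K * norm (x - u *\<^sub>C A x)" if "cmod u = 1" for u x
      using lowK[of "u * of_real r" x] that r by (simp add: A_def scaleC_scaleC norm_mult)
    have one: "norm ((A ^^ n) x) \<le> norm x" for x
    proof -
      have "norm ((A ^^ n) x) \<le> r ^ n * (onorm (T ^^ n) * norm x)"
        unfolding Apow using r
        by (intro mult_left_mono bounded_clinear_norm_le bounded_clinear_funpow T) simp
      then show ?thesis using r(3) by (simp add: mult.assoc[symmetric])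
    qed
    have "n > 0" using that by simp
    note bound = power_bound_of_lower_bound[OF A K this lowA one]
    \<comment> \<open>The averaging bound concerns \<open>A ^^ (n - 1)\<close>; one more factor
      \<open>A\<close> costs at most \<open>R * onorm T\<close>. Hence \<open>c\<close> bounds
      \<open>?f r\<close>, while the choice of \<open>N\<close> makes it less than 1.\<close>
    define c where "c = R * onorm T * (4 * K\<^sup>2) / real n"
    have c: "c < 1" using N that \<open>n > 0\<close> by (simp add: c_def divide_less_eq)
    have "norm ((T ^^ n) x) \<le> c / r ^ n * norm x" for x
    proof -
      have "A ^^ n = A \<circ> A ^^ (n - 1)" using \<open>n > 0\<close> by (metis Suc_pred' funpow.simps(2))
      then have "norm ((A ^^ n) x) = r * norm (T ((A ^^ (n - 1)) x))"
        using r by (simp add: A_def norm_scaleC)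
      also have "\<dots> \<le> R * (onorm T * norm ((A ^^ (n - 1)) x))"
        using r by (intro mult_mono bounded_clinear_norm_le T) auto
      also have "\<dots> \<le> R * (onorm T * (4 * K\<^sup>2 * norm x / real n))"
        using bound[of x] \<open>n > 0\<close> R Tpos
        by (intro mult_left_mono) (simp_all add: pos_le_divide_eq mult.commute)
      also have "\<dots> = c * norm x" by (simp add: c_def)
      finally show ?thesis using rpos by (simp add: Apow pos_le_divide_eq mult.commute)
    qed
    moreover have "0 \<le> c" using R Tpos by (simp add: c_def)
    ultimately have "onorm (T ^^ n) \<le> c / r ^ n" using rpos by (intro onorm_bound) simp_all
    then have "?f r \<le> c" using rpos by (simp add: pos_le_divide_eq mult.commute)
    then show False using r c by simp
  qed
  then show ?thesis by blast
qed

text \<open>The resolvent comes from solving x = (y + T x) / c by Banach's fixed point theorem. A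
  bounded spectrum is needed because \<open>spectral_radius\<close> is a real supremum, which says
  nothing about an unbounded set.\<close>

lemma spectrum_bounded:
  fixes T :: "'a::chilbert_space \<Rightarrow> 'a"
  assumes T: "bounded_clinear T" and c: "onorm T < cmod c"
  shows "c \<notin> spectrum T"
proof -
  have Tpos: "onorm T \<ge> 0" by (rule onorm_pos_le[OF bounded_clinear_linear[OF T]])
  with c have c0: "c \<noteq> 0" by auto
  interpret T: bounded_linear T using T by (rule bounded_clinear_linear)
  have "\<exists>!x. inverse c *\<^sub>C (y + T x) = x" for y
  proof (rule banach_fix_type)
    show "0 \<le> onorm T / cmod c" "onorm T / cmod c < 1" using c Tpos by (auto simp: divide_less_eq)
    show "\<forall>x x'. dist (inverse c *\<^sub>C (y + T x)) (inverse c *\<^sub>C (y + T x')) \<le> onorm T / cmod c * dist x x'"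
    proof (intro allI)
      fix x x'
      have "dist (inverse c *\<^sub>C (y + T x)) (inverse c *\<^sub>C (y + T x')) = norm (T (x - x')) / cmod c"
        by (simp add: dist_norm complex_vector.scale_right_diff_distrib[symmetric] norm_scaleC
            norm_inverse T.diff divide_inverse mult.commute)
      also have "\<dots> \<le> onorm T * norm (x - x') / cmod c"
        using bounded_clinear_norm_le[OF T, of "x - x'"] by (intro divide_right_mono) auto
      finally show "dist (inverse c *\<^sub>C (y + T x)) (inverse c *\<^sub>C (y + T x')) \<le> onorm T / cmod c * dist x x'"
        by (simp add: dist_norm)
    qed
  qed
  moreover have "inverse c *\<^sub>C (y + T x) = x \<longleftrightarrow> c *\<^sub>C x - T x = y" for x y
  proof -
    have "inverse c *\<^sub>C v = x \<longleftrightarrow> v = c *\<^sub>C x" for v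
      using c0 by (auto simp: scaleC_scaleC scaleC_one)
    then show ?thesis unfolding diff_eq_eq by metis
  qed
  ultimately have ex1: "\<exists>!x. c *\<^sub>C x - T x = y" for y by simp
  then obtain Q where Q: "\<And>y. c *\<^sub>C Q y - T (Q y) = y" by metis
  have Q': "Q (c *\<^sub>C x - T x) = x" for x using ex1 Q by metis
  have "bounded_clinear Q"
  proof (rule bounded_clinearI)
    show "Q (x + y) = Q x + Q y" for x y
      using Q'[of "Q x + Q y"] Q[of x] Q[of y] by (simp add: scaleC_add_right T.add algebra_simps)
    show "Q (a *\<^sub>C x) = a *\<^sub>C Q x" for a x
    proof -
      have "c *\<^sub>C a *\<^sub>C Q x - T (a *\<^sub>C Q x) = a *\<^sub>C (c *\<^sub>C Q x - T (Q x))"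
        by (simp add: bounded_clinear_scaleC[OF T] scaleC_scaleC mult.commute
            complex_vector.scale_right_diff_distrib)
      then show ?thesis using Q'[of "a *\<^sub>C Q x"] by (simp add: Q)
    qed
    show "norm (Q y) \<le> inverse (cmod c - onorm T) * norm y" for y
    proof -
      have "cmod c * norm (Q y) = norm (y + T (Q y))"
        using Q[of y] by (simp add: norm_scaleC[symmetric] algebra_simps)
      also have "\<dots> \<le> norm y + onorm T * norm (Q y)"
        using norm_triangle_ineq[of y "T (Q y)"] bounded_clinear_norm_le[OF T, of "Q y"] by simp
      finally show ?thesis using c by (simp add: field_simps)
    qed
  qed
  then show ?thesis using Q Q' by (auto simp: spectrum_def)
qed

text \<open>Take \<open>q\<close> strictly between the spectral radius and 1. For nonzero
  \<open>w\<close> with \<open>cmod w \<le> 1 / q\<close> the point 1/w lies outside the spectrum,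
  and I - w T = w (1/w - T) is bounded below through the resolvent.\<close>

lemma power_bound_of_spectral_radius:
  fixes T :: "'a::chilbert_space \<Rightarrow> 'a"
  assumes T: "bounded_clinear T" and r: "spectral_radius T < 1"
  shows "\<exists>M q. 0 \<le> q \<and> q < 1 \<and> (\<forall>n. onorm (T ^^ n) \<le> M * q ^ n)"
proof -
  have bdd: "bdd_above (insert 0 (cmod ` spectrum T))"
    using spectrum_bounded[OF T] by (intro bdd_aboveI2[where M = "onorm T", THEN bdd_above_insert[THEN iffD2]])
      (auto simp: not_less[symmetric])
  then have r0: "0 \<le> spectral_radius T" unfolding spectral_radius_def by (intro cSup_upper) auto
  obtain q where q: "spectral_radius T < q" "q < 1" using dense r by blast
  have qpos: "q > 0" using q r0 by simp
  have "\<exists>K. \<forall>x. norm x \<le> K * norm (x - w *\<^sub>C T x)" if w: "cmod w \<le> 1 / q" for w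
  proof (cases "w = 0")
    case True
    then show ?thesis by (intro exI[of _ 1]) simp
  next
    case False
    have "q \<le> cmod (inverse w)" using w qpos False unfolding norm_inverse by (simp add: field_simps)
    moreover have "cmod v \<le> spectral_radius T" if "v \<in> spectrum T" for v
      unfolding spectral_radius_def using that bdd by (intro cSup_upper) auto
    ultimately have "inverse w \<notin> spectrum T" using q by fastforce
    then obtain Q where Q: "bounded_clinear Q" "\<And>x. Q (inverse w *\<^sub>C x - T x) = x"
      by (auto simp: spectrum_def)
    have "norm x \<le> onorm Q * cmod (inverse w) * norm (x - w *\<^sub>C T x)" for x
    proof -
      have eq: "inverse w *\<^sub>C x - T x = inverse w *\<^sub>C (x - w *\<^sub>C T x)"
        using False by (simp add: complex_vector.scale_right_diff_distrib)
      have "norm x \<le> onorm Q * norm (inverse w *\<^sub>C x - T x)"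
        using bounded_clinear_norm_le[OF Q(1), of "inverse w *\<^sub>C x - T x"] by (simp only: Q(2))
      then show ?thesis by (simp only: eq norm_scaleC mult.assoc)
    qed
    then show ?thesis by blast
  qed
  then have "\<exists>N. \<forall>n\<ge>N. (1 / q) ^ n * onorm (T ^^ n) < 1"
    using qpos by (intro power_lt_one_of_lower_bounds T) auto
  then obtain N where N: "\<And>n. n \<ge> N \<Longrightarrow> (1 / q) ^ n * onorm (T ^^ n) < 1" by blast
  \<comment> \<open>The 1 covers all exponents from \<open>N\<close> on, the sum covers the finitely
    many before.\<close>
  define M where "M = 1 + (\<Sum>n<N. (1 / q) ^ n * onorm (T ^^ n))"
  have pos: "0 \<le> (1 / q) ^ n * onorm (T ^^ n)" for n
    using qpos by (intro mult_nonneg_nonneg onorm_pos_le bounded_clinear_linear bounded_clinear_funpow T) simp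
  have "(1 / q) ^ n * onorm (T ^^ n) \<le> M" for n
  proof (cases "n < N")
    case True
    then have "(1 / q) ^ n * onorm (T ^^ n) \<le> (\<Sum>n<N. (1 / q) ^ n * onorm (T ^^ n))"
      by (intro member_le_sum[of n "{..<N}" "\<lambda>n. (1 / q) ^ n * onorm (T ^^ n)"] pos) auto
    then show ?thesis by (simp add: M_def)
  next
    case False
    then have "(1 / q) ^ n * onorm (T ^^ n) \<le> 1" using N[of n] by simp
    also have "1 \<le> M" unfolding M_def using sum_nonneg[of "{..<N}" "\<lambda>n. (1 / q) ^ n * onorm (T ^^ n)"] pos by simp
    finally show ?thesis .
  qed
  then have "onorm (T ^^ n) \<le> M * q ^ n" for n
    using qpos by (simp add: power_one_over field_simps)
  then show ?thesis using q qpos by (intro exI[of _ M] exI[of _ q]) auto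
qed

section \<open>Polynomials in commuting operators\<close>

definition orthonormal :: "'a::chilbert_space set \<Rightarrow> bool"
  where "orthonormal E \<longleftrightarrow> finite E \<and> (\<forall>e\<in>E. \<forall>f\<in>E. cinner e f = (if e = f then 1 else 0))"

lemma cinner_orthonormal_sum:
  assumes "orthonormal E" "f \<in> E"
  shows "cinner (\<Sum>e\<in>E. a e *\<^sub>C e) f = a f"
proof -
  have "cinner (\<Sum>e\<in>E. a e *\<^sub>C e) f = (\<Sum>e\<in>E. if e = f then a f else 0)"
    unfolding cinner_sum_left cinner_scaleC_left
    using assms by (intro sum.cong) (auto simp: orthonormal_def)
  then show ?thesis using assms by (simp add: orthonormal_def)
qed

lemma norm_orthonormal_sum:
  assumes "orthonormal E"
  shows "(norm (\<Sum>e\<in>E. a e *\<^sub>C e))\<^sup>2 = (\<Sum>e\<in>E. (cmod (a e))\<^sup>2)"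
proof -
  have "complex_of_real ((norm (\<Sum>e\<in>E. a e *\<^sub>C e))\<^sup>2) =
      (\<Sum>f\<in>E. cnj (a f) * cinner (\<Sum>e\<in>E. a e *\<^sub>C e) f)"
    unfolding cinner_self[symmetric] by (subst cinner_sum_right) (simp only: cinner_scaleC_right)
  also have "\<dots> = (\<Sum>f\<in>E. complex_of_real ((cmod (a f))\<^sup>2))"
    by (intro sum.cong refl) (simp only: cinner_orthonormal_sum[OF assms] complex_norm_square mult.commute)
  also have "\<dots> = complex_of_real (\<Sum>f\<in>E. (cmod (a f))\<^sup>2)" by simp
  finally show ?thesis by (simp only: of_real_eq_iff)
qed

text \<open>Gram-Schmidt, one vector at a time: the residual of the new vector either vanishes or,
  normalized, joins the family. It reduces norm estimates for finitely many vectors to finite sums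
  of coordinates.\<close>

lemma orthonormal_expansion:
  fixes v :: "'i \<Rightarrow> 'a::chilbert_space"
  assumes "finite I"
  shows "\<exists>E. orthonormal E \<and> (\<forall>i\<in>I. v i = (\<Sum>e\<in>E. cinner (v i) e *\<^sub>C e))"
  using assms
proof (induction I rule: finite_induct)
  case empty
  then show ?case by (intro exI[of _ "{}"]) (simp add: orthonormal_def)
next
  case (insert j I)
  then obtain E where E: "orthonormal E" and v: "\<And>i. i \<in> I \<Longrightarrow> v i = (\<Sum>e\<in>E. cinner (v i) e *\<^sub>C e)"
    by blast
  define p where "p = (\<Sum>e\<in>E. cinner (v j) e *\<^sub>C e)"
  define r where "r = v j - p"
  have r_orth: "cinner r e = 0" if "e \<in> E" for e
    using cinner_orthonormal_sum[OF E that, of "\<lambda>e. cinner (v j) e"]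
    by (simp add: r_def p_def cinner_diff_left)
  show ?case
  proof (cases "r = 0")
    case True
    then have "v j = (\<Sum>e\<in>E. cinner (v j) e *\<^sub>C e)" by (simp add: r_def p_def)
    then show ?thesis using E v by (intro exI[of _ E]) auto
  next
    case False
    define f where "f = complex_of_real (inverse (norm r)) *\<^sub>C r"
    have rf: "r = complex_of_real (norm r) *\<^sub>C f"
      using False by (simp add: f_def scaleC_scaleC scaleC_one of_real_mult[symmetric] del: of_real_mult of_real_inverse)
    have "norm f = 1" using False by (simp add: f_def norm_scaleC norm_inverse)
    then have f1: "cinner f f = 1" by (simp add: cinner_self)
    have f_orth: "cinner f e = 0" "cinner e f = 0" if "e \<in> E" for e
    proof -
      show "cinner f e = 0" using r_orth[OF that] by (simp add: f_def cinner_scaleC_left)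
      then show "cinner e f = 0" by (subst cinner_commute) simp
    qed
    have "f \<notin> E" using f1 f_orth(1)[of f] by auto
    have "orthonormal (insert f E)"
      using E f1 f_orth \<open>f \<notin> E\<close> unfolding orthonormal_def by auto
    moreover have "v i = (\<Sum>e\<in>insert f E. cinner (v i) e *\<^sub>C e)" if "i \<in> insert j I" for i
    proof -
      have split: "(\<Sum>e\<in>insert f E. cinner (v i) e *\<^sub>C e) =
          cinner (v i) f *\<^sub>C f + (\<Sum>e\<in>E. cinner (v i) e *\<^sub>C e)"
        using E \<open>f \<notin> E\<close> by (intro sum.insert) (auto simp: orthonormal_def)
      have perp: "cinner (\<Sum>e\<in>E. a e *\<^sub>C e) f = 0" for a
        by (simp add: cinner_sum_left cinner_scaleC_left f_orth)
      show ?thesis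
      proof (cases "i = j")
        case True
        have "v j = r + p" by (simp add: r_def)
        moreover from this have "cinner (v j) f = of_real (norm r)"
          unfolding p_def by (metis add.right_neutral cinner_add_left cinner_scaleC_left f1 mult.right_neutral perp rf)
        ultimately show ?thesis using rf True split by (simp add: p_def)
      next
        case False
        then have vi: "v i = (\<Sum>e\<in>E. cinner (v i) e *\<^sub>C e)" using that v by blast
        then have "cinner (v i) f = 0" using perp by metis
        then show ?thesis using split vi by simp
      qed
    qed
    ultimately show ?thesis by blast
  qed
qed

lemma norm_vec_square: "(norm v)\<^sup>2 = (\<Sum>i\<in>UNIV. (norm (v $ i))\<^sup>2)"
  by (simp add: norm_vec_def L2_set_def sum_nonneg)

text \<open>In coordinates with respect to an orthonormal family that spans the components of \<open>v\<close>, the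
  amplification acts as the scalar matrix on each coordinate vector.\<close>

lemma scalar_matrix_amplification:
  fixes M :: "complex ^ 'm ^ 'm" and v :: "'a::chilbert_space ^ 'm"
  shows "(\<Sum>s\<in>UNIV. (norm (\<Sum>t\<in>UNIV. M $ s $ t *\<^sub>C v $ t))\<^sup>2) \<le> (onorm ((*v) M))\<^sup>2 * (norm v)\<^sup>2"
proof -
  obtain E where E: "orthonormal E"
    and v: "\<And>t. v $ t = (\<Sum>e\<in>E. cinner (v $ t) e *\<^sub>C e)"
    using orthonormal_expansion[of UNIV "\<lambda>t. v $ t"] by auto
  define c where "c e = (\<chi> t. cinner (v $ t) e)" for e
  have v': "v $ t = (\<Sum>e\<in>E. c e $ t *\<^sub>C e)" for t using v by (simp add: c_def)
  have "(\<Sum>t\<in>UNIV. M $ s $ t *\<^sub>C v $ t) = (\<Sum>e\<in>E. (M *v c e) $ s *\<^sub>C e)" for s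
  proof -
    have "(\<Sum>t\<in>UNIV. M $ s $ t *\<^sub>C v $ t) = (\<Sum>t\<in>UNIV. \<Sum>e\<in>E. (M $ s $ t * c e $ t) *\<^sub>C e)"
      by (subst v') (simp add: complex_vector.scale_sum_right scaleC_scaleC)
    also have "\<dots> = (\<Sum>e\<in>E. (M *v c e) $ s *\<^sub>C e)"
      by (subst sum.swap) (simp add: matrix_vector_mult_def complex_vector.scale_sum_left)
    finally show ?thesis .
  qed
  then have "(\<Sum>s\<in>UNIV. (norm (\<Sum>t\<in>UNIV. M $ s $ t *\<^sub>C v $ t))\<^sup>2) =
      (\<Sum>s\<in>UNIV. \<Sum>e\<in>E. (cmod ((M *v c e) $ s))\<^sup>2)"
    by (simp add: norm_orthonormal_sum[OF E])
  also have "\<dots> = (\<Sum>e\<in>E. (norm (M *v c e))\<^sup>2)"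
    by (subst sum.swap) (simp add: norm_vec_square)
  also have "\<dots> \<le> (\<Sum>e\<in>E. (onorm ((*v) M))\<^sup>2 * (norm (c e))\<^sup>2)"
    unfolding power_mult_distrib[symmetric]
    by (intro sum_mono power_mono onorm matrix_vector_mul_bounded_linear norm_ge_zero)
  also have "\<dots> = (onorm ((*v) M))\<^sup>2 * (\<Sum>t\<in>UNIV. \<Sum>e\<in>E. (cmod (c e $ t))\<^sup>2)"
    by (subst sum.swap) (simp add: norm_vec_square sum_distrib_left)
  also have "(\<Sum>t\<in>UNIV. \<Sum>e\<in>E. (cmod (c e $ t))\<^sup>2) = (norm v)\<^sup>2"
    unfolding norm_vec_square v' norm_orthonormal_sum[OF E] ..
  finally show ?thesis .
qed

text \<open>All coordinates are N-th roots of unity and \<open>g\<close> lists their exponents; this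
  is the finite substitute for integration over the torus.\<close>

definition torus_grid :: "nat \<Rightarrow> ('k::finite \<Rightarrow> nat) \<Rightarrow> complex ^ 'k"
  where "torus_grid N g = (\<chi> i. cis (2 * pi / real N) ^ g i)"

text \<open>The sum factors into one geometric sum per coordinate. Exponents below \<open>N\<close>
  that agree modulo \<open>N\<close> are equal, so distinct monomials are not confused on the
  grid.\<close>

lemma sum_torus_grid_orthogonal:
  fixes \<alpha> \<beta> :: "'k::finite \<Rightarrow> nat"
  assumes \<alpha>: "\<And>i. \<alpha> i < N" and \<beta>: "\<And>i. \<beta> i < N"
  shows "(\<Sum>g\<in>PiE UNIV (\<lambda>_. {..<N}). mpow (torus_grid N g) \<alpha> * cnj (mpow (torus_grid N g) \<beta>)) =
    (if \<alpha> = \<beta> then of_nat N ^ CARD('k) else 0)"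
proof -
  define w where "w = cis (2 * pi / real N)"
  have N: "N > 0" using \<alpha>[of undefined] by simp
  note w = root_of_unity_prim[OF N, folded w_def]
  have one: "w ^ a * cnj (w ^ b) = 1 \<longleftrightarrow> a = b" if "a < N" "b < N" for a b
  proof -
    have aux: "w ^ a * cnj (w ^ b) \<noteq> 1" if "b < a" "a < N" for a b
    proof -
      have "w ^ a = w ^ (a - b) * w ^ b" using that by (simp add: power_add[symmetric])
      then have "w ^ a * cnj (w ^ b) = w ^ (a - b) * (w * cnj w) ^ b"
        by (simp add: power_mult_distrib)
      then show ?thesis using w(3) w(4)[of "a - b"] that by simp
    qed
    show ?thesis
    proof (cases a b rule: linorder_cases)
      case less
      then have "w ^ b * cnj (w ^ a) \<noteq> 1" using aux that by blast
      then have "cnj (w ^ b * cnj (w ^ a)) \<noteq> 1" by (metis complex_cnj_cnj complex_cnj_one)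
      then show ?thesis using less by (simp add: mult.commute)
    next
      case equal
      have "w ^ b * cnj (w ^ b) = (w * cnj w) ^ b" by (simp add: power_mult_distrib)
      then show ?thesis using equal w(3) by simp
    next
      case greater
      then show ?thesis using aux that by blast
    qed
  qed
  have root: "(w ^ a * cnj (w ^ b)) ^ N = 1" for a b
    by (simp add: power_mult_distrib power_mult[symmetric] mult.commute[of _ N])
      (simp add: power_mult w(1) flip: complex_cnj_power)
  have "(\<Sum>g\<in>PiE UNIV (\<lambda>_. {..<N}). mpow (torus_grid N g) \<alpha> * cnj (mpow (torus_grid N g) \<beta>)) =
      (\<Sum>g\<in>PiE UNIV (\<lambda>_. {..<N}). \<Prod>i\<in>UNIV. (w ^ \<alpha> i * cnj (w ^ \<beta> i)) ^ g i)"
    unfolding mpow_def torus_grid_def w_def[symmetric] vec_lambda_beta cnj_prod prod.distrib[symmetric]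
    by (intro sum.cong prod.cong refl) (simp add: power_mult_distrib power_mult[symmetric] mult.commute)
  also have "\<dots> = (\<Prod>i\<in>UNIV. \<Sum>n<N. (w ^ \<alpha> i * cnj (w ^ \<beta> i)) ^ n)"
    by (rule prod_sum_PiE[symmetric]) auto
  also have "\<dots> = (\<Prod>i\<in>UNIV. if \<alpha> i = \<beta> i then of_nat N else 0)"
    by (intro prod.cong refl) (simp only: sum_powers_root[OF root] one[OF \<alpha> \<beta>])
  also have "\<dots> = (if \<alpha> = \<beta> then of_nat N ^ CARD('k) else 0)"
    by (auto simp: fun_eq_iff)
  finally show ?thesis .
qed

lemma parseval_torus_grid:
  fixes W :: "('k::finite \<Rightarrow> nat) \<Rightarrow> 'a::chilbert_space"
  assumes "\<And>\<alpha> i. \<alpha> \<in> F \<Longrightarrow> \<alpha> i < N" and "finite F"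
  shows "(\<Sum>g\<in>PiE UNIV (\<lambda>_. {..<N}). (norm (\<Sum>\<alpha>\<in>F. mpow (torus_grid N g) \<alpha> *\<^sub>C W \<alpha>))\<^sup>2) =
    real N ^ CARD('k) * (\<Sum>\<alpha>\<in>F. (norm (W \<alpha>))\<^sup>2)"
proof -
  let ?G = "PiE UNIV (\<lambda>_. {..<N}) :: ('k \<Rightarrow> nat) set"
  let ?z = "torus_grid N"
  have "complex_of_real (\<Sum>g\<in>?G. (norm (\<Sum>\<alpha>\<in>F. mpow (?z g) \<alpha> *\<^sub>C W \<alpha>))\<^sup>2) =
      (\<Sum>g\<in>?G. \<Sum>\<alpha>\<in>F. \<Sum>\<beta>\<in>F. mpow (?z g) \<alpha> * cnj (mpow (?z g) \<beta>) * cinner (W \<alpha>) (W \<beta>))"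
    unfolding of_real_sum cinner_self[symmetric] cinner_sum_left
    by (simp add: cinner_sum_right cinner_scaleC_left cinner_scaleC_right sum_distrib_left mult_ac)
  also have "\<dots> = (\<Sum>\<alpha>\<in>F. \<Sum>\<beta>\<in>F. (\<Sum>g\<in>?G. mpow (?z g) \<alpha> * cnj (mpow (?z g) \<beta>)) * cinner (W \<alpha>) (W \<beta>))"
    unfolding sum_distrib_right
    by (subst sum.swap, rule sum.cong[OF refl], rule sum.swap)
  also have "\<dots> = (\<Sum>\<alpha>\<in>F. \<Sum>\<beta>\<in>F. if \<alpha> = \<beta> then of_nat N ^ CARD('k) * cinner (W \<alpha>) (W \<alpha>) else 0)"
    by (intro sum.cong refl) (auto simp: sum_torus_grid_orthogonal assms)
  also have "\<dots> = complex_of_real (real N ^ CARD('k) * (\<Sum>\<alpha>\<in>F. (norm (W \<alpha>))\<^sup>2))"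
    using assms(2) by (simp add: cinner_self sum_distrib_left)
  finally show ?thesis by (simp only: of_real_eq_iff)
qed

section \<open>Monomials in commuting operators\<close>

lemma comp_funpow_commute:
  assumes "f \<circ> g = g \<circ> f"
  shows "f \<circ> g ^^ n = g ^^ n \<circ> f"
proof (induction n)
  case (Suc n)
  have "f \<circ> g ^^ Suc n = (f \<circ> g) \<circ> g ^^ n" by (simp add: comp_assoc)
  also have "\<dots> = g \<circ> (f \<circ> g ^^ n)" by (simp add: assms comp_assoc)
  also have "\<dots> = g ^^ Suc n \<circ> f" by (simp only: Suc funpow.simps comp_assoc)
  finally show ?case .
qed simp

locale commuting_tuple =
  fixes C :: "'k::finite \<Rightarrow> 'a::chilbert_space \<Rightarrow> 'a"
  assumes bounded: "\<And>i. bounded_clinear (C i)"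
    and commuting: "\<And>i j. C i \<circ> C j = C j \<circ> C i"
begin

text \<open>The fold of \<open>op_mpow\<close> over an arbitrary index set, which opens the way to
  induction on that set.\<close>

definition mpow_on :: "'k set \<Rightarrow> ('k \<Rightarrow> nat) \<Rightarrow> 'a \<Rightarrow> 'a"
  where "mpow_on A \<alpha> = Finite_Set.fold (\<lambda>i T. (C i ^^ \<alpha> i) \<circ> T) id A"

lemma op_mpow_eq: "op_mpow C \<alpha> = mpow_on UNIV \<alpha>"
  by (simp add: op_mpow_def mpow_on_def)

lemma mpow_on_empty [simp]: "mpow_on {} \<alpha> = id"
  by (simp add: mpow_on_def)

lemma mpow_on_insert:
  assumes "finite A" "i \<notin> A"
  shows "mpow_on (insert i A) \<alpha> = (C i ^^ \<alpha> i) \<circ> mpow_on A \<alpha>"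
proof -
  have "(C i ^^ m) \<circ> (C j ^^ n) = (C j ^^ n) \<circ> (C i ^^ m)" for i j m n
    by (rule comp_funpow_commute, rule comp_funpow_commute[symmetric], rule commuting)
  then interpret comp_fun_commute "\<lambda>i T. (C i ^^ \<alpha> i) \<circ> T"
    by unfold_locales (simp add: fun_eq_iff)
  show ?thesis unfolding mpow_on_def using assms by (simp add: fold_insert)
qed

lemma bounded_op_mpow: "bounded_clinear (op_mpow C \<alpha>)"
proof -
  have "bounded_clinear (mpow_on A \<alpha>)" if "finite A" for A
    using that
  proof induction
    case empty
    show ?case unfolding mpow_on_empty by (rule bounded_clinear_id)
  next
    case (insert i A)
    then show ?case
      unfolding mpow_on_insert[OF insert.hyps]
      by (intro bounded_clinear_compose bounded_clinear_funpow bounded)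
  qed
  then show ?thesis by (simp add: op_mpow_eq)
qed

lemma onorm_funpow_nonneg: "0 \<le> onorm (C i ^^ n)"
  by (intro onorm_pos_le bounded_clinear_linear bounded_clinear_funpow bounded)

lemma norm_op_mpow_le: "norm (op_mpow C \<alpha> x) \<le> (\<Prod>i\<in>UNIV. onorm (C i ^^ \<alpha> i)) * norm x"
proof -
  have "norm (mpow_on A \<alpha> x) \<le> (\<Prod>i\<in>A. onorm (C i ^^ \<alpha> i)) * norm x" if "finite A" for A
    using that
  proof induction
    case (insert i A)
    have "norm (mpow_on (insert i A) \<alpha> x) \<le> onorm (C i ^^ \<alpha> i) * norm (mpow_on A \<alpha> x)"
      unfolding mpow_on_insert[OF insert.hyps] o_apply
      by (intro bounded_clinear_norm_le bounded_clinear_funpow bounded)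
    also have "\<dots> \<le> onorm (C i ^^ \<alpha> i) * ((\<Prod>i\<in>A. onorm (C i ^^ \<alpha> i)) * norm x)"
      by (intro mult_left_mono insert.IH onorm_funpow_nonneg)
    finally show ?case using insert.hyps by (simp add: mult.assoc)
  qed simp
  then show ?thesis by (simp add: op_mpow_eq)
qed

lemma op_mpow_0: "op_mpow C (\<lambda>_. 0) = id"
proof -
  have "mpow_on A (\<lambda>_. 0) = id" if "finite A" for A
    using that by induction (simp_all add: mpow_on_insert)
  then show ?thesis by (simp add: op_mpow_eq)
qed

text \<open>The additional factor is placed on the right, so that it acts first: a monomial applied
  to \<open>C i h\<close> is the next higher monomial applied to \<open>h\<close>. The intertwining
  in \<open>backward_shift_embed\<close> needs this form.\<close>

lemma op_mpow_Suc: "op_mpow C (\<alpha>(i := Suc (\<alpha> i))) = op_mpow C \<alpha> \<circ> C i"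
proof -
  have comm: "C i \<circ> mpow_on A \<alpha> = mpow_on A \<alpha> \<circ> C i" if "finite A" for A
    using that
  proof induction
    case (insert j A)
    have "C i \<circ> mpow_on (insert j A) \<alpha> = (C i \<circ> C j ^^ \<alpha> j) \<circ> mpow_on A \<alpha>"
      by (simp add: mpow_on_insert insert.hyps comp_assoc)
    also have "\<dots> = C j ^^ \<alpha> j \<circ> (C i \<circ> mpow_on A \<alpha>)"
      by (simp only: comp_funpow_commute[OF commuting] comp_assoc)
    also have "\<dots> = mpow_on (insert j A) \<alpha> \<circ> C i"
      by (simp only: mpow_on_insert[OF insert.hyps] insert.IH comp_assoc)
    finally show ?case .
  qed simp
  have "mpow_on A (\<alpha>(i := Suc (\<alpha> i))) = (if i \<in> A then mpow_on A \<alpha> \<circ> C i else mpow_on A \<alpha>)"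
    if "finite A" for A
    using that
  proof induction
    case (insert j A)
    show ?case
    proof (cases "j = i")
      case True
      then have "mpow_on A (\<alpha>(i := Suc (\<alpha> i))) = mpow_on A \<alpha>"
        using insert.IH insert.hyps(2) by metis
      then have "mpow_on (insert j A) (\<alpha>(i := Suc (\<alpha> i))) = C i ^^ \<alpha> i \<circ> (C i \<circ> mpow_on A \<alpha>)"
        using mpow_on_insert[OF insert.hyps] True
        by (simp only: fun_upd_same funpow_Suc_right comp_assoc)
      then show ?thesis
        using True mpow_on_insert[OF insert.hyps, of \<alpha>]
        by (simp only: insertI1 if_True comm[OF insert.hyps(1)] comp_assoc)
    next
      case False
      then show ?thesis using insert by (auto simp: mpow_on_insert comp_assoc)
    qed
  qed simp
  then show ?thesis by (simp add: op_mpow_eq)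
qed

text \<open>This is where b arises. After Cauchy-Schwarz the squared weights are summed over a box
  containing \<open>F\<close>; there the sum factors into a product of partial sums, each below its
  series.\<close>

lemma op_mpow_sum_bound:
  assumes F: "finite F"
    and summ: "\<And>i. summable (\<lambda>n. (onorm (C i ^^ n))\<^sup>2)"
  shows "(norm (\<Sum>\<alpha>\<in>F. op_mpow C \<alpha> (w \<alpha>)))\<^sup>2 \<le>
    (\<Prod>i\<in>UNIV. suminf (\<lambda>n. (onorm (C i ^^ n))\<^sup>2)) * (\<Sum>\<alpha>\<in>F. (norm (w \<alpha>))\<^sup>2)"
proof -
  define c where "c \<alpha> = (\<Prod>i\<in>UNIV. onorm (C i ^^ \<alpha> i))" for \<alpha>
  obtain N where N: "\<And>\<alpha> i. \<alpha> \<in> F \<Longrightarrow> \<alpha> i < N"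
  proof
    fix \<alpha> i assume "\<alpha> \<in> F"
    then have "\<alpha> i \<le> (\<Sum>i\<in>UNIV. \<alpha> i)" "(\<Sum>i\<in>UNIV. \<alpha> i) \<le> (\<Sum>\<alpha>\<in>F. \<Sum>i\<in>UNIV. \<alpha> i)"
      using F by (auto intro: member_le_sum)
    then show "\<alpha> i < Suc (\<Sum>\<alpha>\<in>F. \<Sum>i\<in>UNIV. \<alpha> i)" by simp
  qed
  have "(\<Sum>\<alpha>\<in>F. (c \<alpha>)\<^sup>2) \<le> (\<Sum>\<alpha>\<in>PiE UNIV (\<lambda>_. {..<N}). (c \<alpha>)\<^sup>2)"
    using N by (intro sum_mono2) (auto intro!: finite_PiE)
  also have "\<dots> = (\<Prod>i\<in>UNIV. \<Sum>n<N. (onorm (C i ^^ n))\<^sup>2)"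
    unfolding c_def prod_power_distrib by (rule prod_sum_PiE[symmetric]) auto
  also have "\<dots> \<le> (\<Prod>i\<in>UNIV. suminf (\<lambda>n. (onorm (C i ^^ n))\<^sup>2))"
    by (intro prod_mono conjI sum_nonneg sum_le_suminf summ) auto
  finally have c: "(\<Sum>\<alpha>\<in>F. (c \<alpha>)\<^sup>2) \<le> (\<Prod>i\<in>UNIV. suminf (\<lambda>n. (onorm (C i ^^ n))\<^sup>2))" .
  have "norm (\<Sum>\<alpha>\<in>F. op_mpow C \<alpha> (w \<alpha>)) \<le> (\<Sum>\<alpha>\<in>F. c \<alpha> * norm (w \<alpha>))"
    by (intro sum_norm_le) (simp add: c_def norm_op_mpow_le)
  then have "(norm (\<Sum>\<alpha>\<in>F. op_mpow C \<alpha> (w \<alpha>)))\<^sup>2 \<le> (\<Sum>\<alpha>\<in>F. c \<alpha> * norm (w \<alpha>))\<^sup>2"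
    by (intro power_mono) auto
  also have "\<dots> \<le> (\<Sum>\<alpha>\<in>F. (c \<alpha>)\<^sup>2) * (\<Sum>\<alpha>\<in>F. (norm (w \<alpha>))\<^sup>2)"
    by (rule Cauchy_Schwarz_ineq_sum)
  also have "\<dots> \<le> (\<Prod>i\<in>UNIV. suminf (\<lambda>n. (onorm (C i ^^ n))\<^sup>2)) * (\<Sum>\<alpha>\<in>F. (norm (w \<alpha>))\<^sup>2)"
    by (intro mult_right_mono c sum_nonneg) simp
  finally show ?thesis .
qed

end

section \<open>The inequality for matrices of polynomials\<close>

lemma cmod_mpow_le: "(\<And>i. cmod (z $ i) \<le> 1) \<Longrightarrow> cmod (mpow z \<alpha>) \<le> 1"
  unfolding mpow_def prod_norm[symmetric] norm_power by (intro prod_le_1) (auto intro: power_le_one)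

text \<open>Without it the real supremum in the theorem would bound nothing. The crude sum of the
  moduli of all coefficients suffices.\<close>

lemma bdd_above_onorm_mpoly_matrix:
  "bdd_above ((\<lambda>z. onorm ((*v) (\<chi> s t. mpoly_eval (q s t) z :: complex ^ 'm::finite ^ 'm))) `
    {z :: complex ^ 'k::finite. \<forall>i. cmod (z $ i) \<le> 1})"
proof (rule bdd_aboveI2)
  define L where "L s t = (\<Sum>\<alpha>\<in>Poly_Mapping.keys (q s t). cmod (Poly_Mapping.lookup (q s t) \<alpha>))" for s t
  fix z :: "complex ^ 'k" assume "z \<in> {z. \<forall>i. cmod (z $ i) \<le> 1}"
  then have L: "cmod (mpoly_eval (q s t) z) \<le> L s t" for s t
    unfolding mpoly_eval_def L_def
    by (intro sum_norm_le) (auto simp: norm_mult intro!: mult_left_le cmod_mpow_le)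
  let ?M = "\<chi> s t. mpoly_eval (q s t) z :: complex ^ 'm ^ 'm"
  show "onorm ((*v) ?M) \<le> (\<Sum>s\<in>UNIV. \<Sum>t\<in>UNIV. L s t)"
  proof (rule onorm_bound)
    show "0 \<le> (\<Sum>s\<in>UNIV. \<Sum>t\<in>UNIV. L s t)"
      unfolding L_def by (intro sum_nonneg) simp
    fix x :: "complex ^ 'm"
    have "norm (?M *v x) \<le> (\<Sum>s\<in>UNIV. cmod ((?M *v x) $ s))"
      unfolding norm_vec_def by (rule L2_set_le_sum) simp
    also have "\<dots> \<le> (\<Sum>s\<in>UNIV. \<Sum>t\<in>UNIV. L s t * norm x)"
      by (intro sum_mono)
        (auto simp: matrix_vector_mult_def norm_mult
          intro!: sum_norm_le mult_mono L Finite_Cartesian_Product.norm_nth_le order_trans[OF norm_ge_zero L])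
    finally show "norm (?M *v x) \<le> (\<Sum>s\<in>UNIV. \<Sum>t\<in>UNIV. L s t) * norm x"
      by (simp add: sum_distrib_right)
  qed
qed

text \<open>The coefficient vectors \<open>W s \<alpha>\<close> link the two sides: weighted with
  monomials in \<open>C\<close> they give the operator matrix applied to \<open>v\<close>
  (\<open>op\<close>), weighted with scalar monomials they give the scalar matrix applied to
  \<open>v\<close> (\<open>ev\<close>).\<close>

lemma (in commuting_tuple) onorm_mpoly_op_matrix_le:
  fixes q :: "'m::finite \<Rightarrow> 'm \<Rightarrow> 'k mpoly"
  assumes summ: "\<And>i. summable (\<lambda>n. (onorm (C i ^^ n))\<^sup>2)"
  shows "onorm (op_matrix (\<lambda>s t. mpoly_op (q s t) C)) \<le>
    sqrt (\<Prod>i\<in>UNIV. suminf (\<lambda>n. (onorm (C i ^^ n))\<^sup>2)) *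
      (SUP z\<in>{z :: complex ^ 'k. \<forall>i. cmod (z $ i) \<le> 1}. onorm ((*v) (\<chi> s t. mpoly_eval (q s t) z)))"
    (is "_ \<le> sqrt ?b * ?S")
proof (rule onorm_bound)
  define M where "M z = (\<chi> s t. mpoly_eval (q s t) z :: complex ^ 'm ^ 'm)" for z :: "complex ^ 'k"
  have M_le: "onorm ((*v) (M z)) \<le> ?S" if "\<And>i. cmod (z $ i) \<le> 1" for z
    unfolding M_def using that by (intro cSUP_upper bdd_above_onorm_mpoly_matrix) auto
  have M_pos: "0 \<le> onorm ((*v) (M z))" for z
    by (intro onorm_pos_le matrix_vector_mul_bounded_linear)
  have S: "0 \<le> ?S" using M_pos[of 0] M_le[of 0] by simp
  have b: "0 \<le> ?b" by (intro prod_nonneg suminf_nonneg summ) auto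
  show "0 \<le> sqrt ?b * ?S" using S b by simp
  fix v :: "'a ^ 'm"
  define F where "F = (\<Union>s\<in>UNIV. \<Union>t\<in>UNIV. Poly_Mapping.keys (q s t))"
  have F: "finite F" by (simp add: F_def)
  have keys: "Poly_Mapping.keys (q s t) \<subseteq> F" for s t by (auto simp: F_def)
  define W where "W s \<alpha> = (\<Sum>t\<in>UNIV. Poly_Mapping.lookup (q s t) \<alpha> *\<^sub>C v $ t)" for s \<alpha>
  \<comment> \<open>Strictly larger than every exponent in use, so that the grid mean is exact;
    positivity allows the later cancellation of \<open>real N ^ CARD('k)\<close>.\<close>
  obtain N where N: "\<And>\<alpha> i. \<alpha> \<in> F \<Longrightarrow> \<alpha> i < N" "N > 0"
  proof
    fix \<alpha> i assume "\<alpha> \<in> F"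
    then have "\<alpha> i \<le> (\<Sum>i\<in>UNIV. \<alpha> i)" "(\<Sum>i\<in>UNIV. \<alpha> i) \<le> (\<Sum>\<alpha>\<in>F. \<Sum>i\<in>UNIV. \<alpha> i)"
      using F by (auto intro: member_le_sum)
    then show "\<alpha> i < Suc (\<Sum>\<alpha>\<in>F. \<Sum>i\<in>UNIV. \<alpha> i)" by simp
  qed simp
  let ?G = "PiE UNIV (\<lambda>_. {..<N}) :: ('k \<Rightarrow> nat) set"
  have op: "op_matrix (\<lambda>s t. mpoly_op (q s t) C) v $ s = (\<Sum>\<alpha>\<in>F. op_mpow C \<alpha> (W s \<alpha>))" for s
  proof -
    have "op_matrix (\<lambda>s t. mpoly_op (q s t) C) v $ s =
        (\<Sum>t\<in>UNIV. \<Sum>\<alpha>\<in>F. Poly_Mapping.lookup (q s t) \<alpha> *\<^sub>C op_mpow C \<alpha> (v $ t))"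
      unfolding op_matrix_def mpoly_op_def vec_lambda_beta
      by (intro sum.cong refl sum.mono_neutral_left F keys) (auto simp: in_keys_iff)
    also have "\<dots> = (\<Sum>\<alpha>\<in>F. op_mpow C \<alpha> (W s \<alpha>))"
      by (subst sum.swap)
        (simp add: W_def bounded_clinear_sum[OF bounded_op_mpow] bounded_clinear_scaleC[OF bounded_op_mpow])
    finally show ?thesis .
  qed
  have ev: "(\<Sum>\<alpha>\<in>F. mpow z \<alpha> *\<^sub>C W s \<alpha>) = (\<Sum>t\<in>UNIV. M z $ s $ t *\<^sub>C v $ t)" for s z
  proof -
    have "mpoly_eval (q s t) z = (\<Sum>\<alpha>\<in>F. Poly_Mapping.lookup (q s t) \<alpha> * mpow z \<alpha>)" for t
      unfolding mpoly_eval_def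
      by (intro sum.mono_neutral_left F keys) (auto simp: in_keys_iff)
    then have "(\<Sum>t\<in>UNIV. M z $ s $ t *\<^sub>C v $ t) =
        (\<Sum>t\<in>UNIV. \<Sum>\<alpha>\<in>F. (mpow z \<alpha> * Poly_Mapping.lookup (q s t) \<alpha>) *\<^sub>C v $ t)"
      by (simp add: M_def complex_vector.scale_sum_left mult.commute)
    also have "\<dots> = (\<Sum>\<alpha>\<in>F. mpow z \<alpha> *\<^sub>C W s \<alpha>)"
      by (subst sum.swap) (simp add: W_def complex_vector.scale_sum_right scaleC_scaleC)
    finally show ?thesis by (rule sym)
  qed
  have "real N ^ CARD('k) * (\<Sum>s\<in>UNIV. \<Sum>\<alpha>\<in>F. (norm (W s \<alpha>))\<^sup>2) =
      (\<Sum>g\<in>?G. \<Sum>s\<in>UNIV. (norm (\<Sum>t\<in>UNIV. M (torus_grid N g) $ s $ t *\<^sub>C v $ t))\<^sup>2)"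
    unfolding sum_distrib_left[symmetric] ev[symmetric]
    by (subst sum.swap, subst parseval_torus_grid[OF _ F])
      (simp_all add: N(1) sum_distrib_left)
  also have "\<dots> \<le> (\<Sum>g\<in>?G. ?S\<^sup>2 * (norm v)\<^sup>2)"
  proof (rule sum_mono)
    fix g :: "'k \<Rightarrow> nat"
    have "cmod (torus_grid N g $ i) \<le> 1" for i by (simp add: torus_grid_def norm_power)
    then have "(onorm ((*v) (M (torus_grid N g))))\<^sup>2 * (norm v)\<^sup>2 \<le> ?S\<^sup>2 * (norm v)\<^sup>2"
      by (intro mult_right_mono power_mono M_le M_pos) auto
    then show "(\<Sum>s\<in>UNIV. (norm (\<Sum>t\<in>UNIV. M (torus_grid N g) $ s $ t *\<^sub>C v $ t))\<^sup>2) \<le> ?S\<^sup>2 * (norm v)\<^sup>2"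
      by (rule order_trans[OF scalar_matrix_amplification])
  qed
  also have "\<dots> = real N ^ CARD('k) * (?S\<^sup>2 * (norm v)\<^sup>2)"
    by (simp add: card_PiE)
  finally have W: "(\<Sum>s\<in>UNIV. \<Sum>\<alpha>\<in>F. (norm (W s \<alpha>))\<^sup>2) \<le> ?S\<^sup>2 * (norm v)\<^sup>2"
    using N(2) by simp
  have "(norm (op_matrix (\<lambda>s t. mpoly_op (q s t) C) v))\<^sup>2 \<le> (\<Sum>s\<in>UNIV. ?b * (\<Sum>\<alpha>\<in>F. (norm (W s \<alpha>))\<^sup>2))"
    unfolding norm_vec_square op by (intro sum_mono op_mpow_sum_bound F summ)
  also have "\<dots> \<le> ?b * (?S\<^sup>2 * (norm v)\<^sup>2)"
    unfolding sum_distrib_left[symmetric] by (intro mult_left_mono W b)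
  also have "\<dots> = (sqrt ?b * ?S * norm v)\<^sup>2" using b by (simp add: power_mult_distrib)
  finally show "norm (op_matrix (\<lambda>s t. mpoly_op (q s t) C) v) \<le> sqrt ?b * ?S * norm v"
    by (rule power2_le_imp_le) (use S b in simp)
qed

section \<open>Shifts and tensor products\<close>

definition incr :: "'k \<Rightarrow> ('k \<Rightarrow> nat) \<Rightarrow> 'k \<Rightarrow> nat"
  where "incr i \<alpha> = \<alpha>(i := Suc (\<alpha> i))"

text \<open>Truncated subtraction fixes \<alpha> when \<open>\<alpha> i = 0\<close>, so
  \<open>decr i\<close> undoes \<open>incr i\<close> but is a right inverse only where
  \<open>\<alpha> i \<noteq> 0\<close>.\<close>

definition decr :: "'k \<Rightarrow> ('k \<Rightarrow> nat) \<Rightarrow> 'k \<Rightarrow> nat"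
  where "decr i \<alpha> = \<alpha>(i := \<alpha> i - 1)"

lemma decr_incr [simp]: "decr i (incr i \<alpha>) = \<alpha>"
  by (simp add: incr_def decr_def)

lemma incr_same [simp]: "incr i \<alpha> i = Suc (\<alpha> i)"
  by (simp add: incr_def)

lemma incr_decr: "\<alpha> i \<noteq> 0 \<Longrightarrow> incr i (decr i \<alpha>) = \<alpha>"
  by (auto simp: incr_def decr_def)

lemma inj_incr: "inj (incr i)"
  by (metis decr_incr injI)

lemma not_in_range_incr: "\<alpha> \<notin> range (incr i) \<Longrightarrow> \<alpha> i = 0"
  by (metis incr_decr rangeI)

text \<open>Reindexing for families that vanish off the range of \<open>incr i\<close>. It serves
  both the Taylor series of a shifted function and the intertwining relation of
  \<open>embed\<close>.\<close>

lemma has_sum_incr: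
  assumes "(f has_sum s) UNIV" "\<And>\<alpha>. g (incr i \<alpha>) = f \<alpha>" "\<And>\<alpha>. \<alpha> i = 0 \<Longrightarrow> g \<alpha> = 0"
  shows "(g has_sum s) UNIV"
proof -
  have "(g has_sum s) (range (incr i))"
    using assms(1) by (simp add: has_sum_reindex[OF inj_incr] o_def assms(2))
  then show ?thesis
    by (rule has_sum_cong_neutral[THEN iffD1, rotated -1])
      (auto simp: assms(3) not_in_range_incr)
qed

lemma mpow_incr: "mpow z (incr i \<alpha>) = z $ i * mpow z \<alpha>"
proof -
  have "mpow z \<beta> = (z $ i) ^ \<beta> i * (\<Prod>j\<in>UNIV - {i}. (z $ j) ^ \<beta> j)" for \<beta>
    unfolding mpow_def by (rule prod.remove) auto
  moreover have "(\<Prod>j\<in>UNIV - {i}. (z $ j) ^ incr i \<alpha> j) = (\<Prod>j\<in>UNIV - {i}. (z $ j) ^ \<alpha> j)"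
    by (intro prod.cong) (auto simp: incr_def)
  ultimately show ?thesis by simp
qed

lemma hcoef_shift: "hcoef (shift i f) \<alpha> = (if \<alpha> i = 0 then 0 else hcoef f (decr i \<alpha>))"
proof -
  have "has_taylor (hardy_fun (shift i f)) (\<lambda>\<alpha>. if \<alpha> i = 0 then 0 else hcoef f (decr i \<alpha>))"
    unfolding has_taylor_def shift.rep_eq
  proof
    fix z :: "complex ^ 'a" assume "z \<in> polydisc"
    then have "((\<lambda>\<alpha>. z $ i * (hcoef f \<alpha> * mpow z \<alpha>)) has_sum z $ i * hardy_fun f z) UNIV"
      using has_taylor_hcoef[of f] by (auto simp: has_taylor_def intro: has_sum_cmult_right)
    then show "((\<lambda>\<alpha>. (if \<alpha> i = 0 then 0 else hcoef f (decr i \<alpha>)) * mpow z \<alpha>) has_sum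
        z $ i * hardy_fun f z) UNIV"
      by (rule has_sum_incr[where i = i]) (simp_all add: mpow_incr mult_ac)
  qed
  from has_taylor_imp_hcoef[OF this] show ?thesis by simp
qed

lemma bounded_clinear_shift: "bounded_clinear (shift i)"
proof (rule bounded_clinearI)
  show "norm (shift i f) \<le> 1 * norm f" for f
  proof (rule norm_hardy_leI)
    fix F :: "('a \<Rightarrow> nat) set" assume F: "finite F"
    \<comment> \<open>The discarded indices carry zero coefficients of the shifted function; on the
      remaining ones \<open>decr i\<close> is injective.\<close>
    define F' where "F' = {\<alpha>\<in>F. \<alpha> i \<noteq> 0}"
    have inj: "inj_on (decr i) F'" by (rule inj_on_inverseI[of _ "incr i"]) (simp add: F'_def incr_decr)
    have "(\<Sum>\<alpha>\<in>F. (cmod (hcoef (shift i f) \<alpha>))\<^sup>2) = (\<Sum>\<alpha>\<in>F'. (cmod (hcoef f (decr i \<alpha>)))\<^sup>2)"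
      unfolding F'_def using F by (intro sum.mono_neutral_cong_right) (auto simp: hcoef_shift)
    also have "\<dots> = (\<Sum>\<alpha>\<in>decr i ` F'. (cmod (hcoef f \<alpha>))\<^sup>2)"
      by (simp add: sum.reindex[OF inj])
    also have "\<dots> \<le> (norm f)\<^sup>2" using F by (intro hcoef_sum_le) (simp add: F'_def)
    finally show "(\<Sum>\<alpha>\<in>F. (cmod (hcoef (shift i f) \<alpha>))\<^sup>2) \<le> (1 * norm f)\<^sup>2" by simp
  qed simp
qed (auto intro!: hardy_eqI simp: fun_eq_iff hcoef_add hcoef_scaleC hcoef_shift)

definition hmono :: "('k \<Rightarrow> nat) \<Rightarrow> 'k::finite hardy"
  where "hmono \<alpha> = of_hcoef (\<lambda>\<beta>. if \<beta> = \<alpha> then 1 else 0)"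

lemma has_sum_single:
  fixes c :: "'b::{comm_monoid_add,topological_space}"
  shows "((\<lambda>x. if x = a then c else 0) has_sum c) UNIV"
proof -
  have "((\<lambda>x. if x = a then c else 0) has_sum c) {a}"
    using has_sum_finite[of "{a}" "\<lambda>x. if x = a then c else 0"] by simp
  then show ?thesis by (rule has_sum_cong_neutral[THEN iffD1, rotated -1]) auto
qed

lemma hcoef_hmono: "hcoef (hmono \<alpha>) = (\<lambda>\<beta>. if \<beta> = \<alpha> then 1 else 0)"
proof -
  have "(\<lambda>\<beta>. (cmod (if \<beta> = \<alpha> then 1 else 0))\<^sup>2) = (\<lambda>\<beta>. if \<beta> = \<alpha> then 1 else 0)" by auto
  then have "(\<lambda>\<beta>. if \<beta> = \<alpha> then 1 else 0) \<in> ell2"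
    using has_sum_single[of \<alpha> "1::real"] by (auto simp: ell2_def summable_on_def)
  then show ?thesis unfolding hmono_def by (rule hcoef_of_hcoef)
qed

lemma cinner_hmono: "cinner f (hmono \<alpha>) = hcoef f \<alpha>"
proof -
  have "(\<lambda>\<beta>. hcoef f \<beta> * cnj (hcoef (hmono \<alpha>) \<beta>)) = (\<lambda>\<beta>. if \<beta> = \<alpha> then hcoef f \<alpha> else 0)"
    by (auto simp: hcoef_hmono)
  then show ?thesis
    unfolding cinner_hardy_def using has_sum_single by (metis infsumI)
qed

text \<open>Pairing with a monomial reads off a coefficient, so \<open>hcoef_shift\<close> dictates
  the adjoint on monomials.\<close>

lemma adj_shift_hmono:
  "adj (shift i) (hmono \<alpha>) = (if \<alpha> i = 0 then 0 else hmono (decr i \<alpha>))"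
  by (rule adj_eqI) (auto simp: bounded_clinear_shift cinner_hmono hcoef_shift)

lemma norm_hmono: "norm (hmono \<alpha>) = 1"
proof -
  have "complex_of_real ((norm (hmono \<alpha>))\<^sup>2) = 1"
    unfolding cinner_self[symmetric] cinner_hmono by (simp add: hcoef_hmono)
  then have "(norm (hmono \<alpha>))\<^sup>2 = 1" by (metis of_real_eq_1_iff)
  then show ?thesis using norm_ge_zero[of "hmono \<alpha>"] by (simp add: power2_eq_1_iff)
qed

section \<open>Construction of the operator A tensor I\<close>

lemma subspace_closure:
  fixes S :: "'a::real_normed_vector set"
  assumes S: "subspace S"
  shows "subspace (closure S)"
proof (rule subspaceI)
  show "0 \<in> closure S" using subspace_0[OF S] closure_subset by blast
next
  fix x y assume "x \<in> closure S" "y \<in> closure S"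
  then obtain f g where "\<And>n. f n \<in> S" "f \<longlonglongrightarrow> x" "\<And>n. g n \<in> S" "g \<longlonglongrightarrow> y"
    unfolding closure_sequential by blast
  then have "\<forall>n. f n + g n \<in> S" "(\<lambda>n. f n + g n) \<longlonglongrightarrow> x + y"
    by (auto intro: tendsto_add subspace_add[OF S])
  then show "x + y \<in> closure S"
    unfolding closure_sequential by (intro exI[of _ "\<lambda>n. f n + g n"]) simp
next
  fix c :: real and x assume "x \<in> closure S"
  then obtain f where "\<And>n. f n \<in> S" "f \<longlonglongrightarrow> x" unfolding closure_sequential by blast
  then have "\<forall>n. c *\<^sub>R f n \<in> S" "(\<lambda>n. c *\<^sub>R f n) \<longlonglongrightarrow> c *\<^sub>R x"
    by (auto intro: tendsto_scaleR subspace_scale[OF S])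
  then show "c *\<^sub>R x \<in> closure S"
    unfolding closure_sequential by (intro exI[of _ "\<lambda>n. c *\<^sub>R f n"]) simp
qed

lemma bounded_linear_scaleC: "bounded_linear (\<lambda>x. c *\<^sub>C (x :: 'a::chilbert_space))"
  using bounded_clinear_scaleC_op[OF bounded_clinear_id, of c]
  by (auto simp: bounded_clinear_def)

locale hilbert_tensor =
  fixes t :: "'a::chilbert_space \<Rightarrow> 'b::chilbert_space \<Rightarrow> 'e::chilbert_space"
  assumes tensor: "hilbert_tensor_product t"
begin

lemma add_left: "t (a + a') b = t a b + t a' b"
  and add_right: "t a (b + b') = t a b + t a b'"
  and scaleC_left: "t (c *\<^sub>C a) b = c *\<^sub>C t a b"
  and scaleC_right: "t a (c *\<^sub>C b) = c *\<^sub>C t a b"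
  and cinner_tensor: "cinner (t a b) (t a' b') = cinner a a' * cinner b b'"
  and dense: "closure (complex_vector.span {t a b | a b. True}) = UNIV"
  using tensor unfolding hilbert_tensor_product_def by blast+

lemma norm_tensor: "norm (t a b) = norm a * norm b"
proof -
  have "complex_of_real ((norm (t a b))\<^sup>2) = complex_of_real ((norm a * norm b)\<^sup>2)"
    unfolding cinner_self[symmetric] cinner_tensor by (simp add: cinner_self power_mult_distrib)
  then have "(norm (t a b))\<^sup>2 = (norm a * norm b)\<^sup>2" by (simp only: of_real_eq_iff)
  then show ?thesis by simp
qed

lemma bounded_clinear_left: "bounded_clinear (\<lambda>a. t a b)"
  by (rule bounded_clinearI[where K = "norm b"]) (simp_all add: add_left scaleC_left norm_tensor)

lemma bounded_clinear_right: "bounded_clinear (t a)"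
  by (rule bounded_clinearI[where K = "norm a"]) (simp_all add: add_right scaleC_right norm_tensor)

lemma zero_left [simp]: "t 0 b = 0"
  using add_left[of 0 0 b] by simp

text \<open>Orthonormal second factors turn the tensor sum into a Hilbert direct sum of copies of
  the first space, on which A tensor I acts diagonally.\<close>

lemma norm_sum_orthonormal:
  assumes "orthonormal E"
  shows "(norm (\<Sum>e\<in>E. t (a e) e))\<^sup>2 = (\<Sum>e\<in>E. (norm (a e))\<^sup>2)"
proof -
  have "complex_of_real ((norm (\<Sum>e\<in>E. t (a e) e))\<^sup>2) =
      (\<Sum>e\<in>E. \<Sum>f\<in>E. cinner (a e) (a f) * cinner e f)"
    unfolding cinner_self[symmetric] cinner_sum_left by (simp add: cinner_sum_right cinner_tensor)
  also have "\<dots> = (\<Sum>e\<in>E. \<Sum>f\<in>E. if e = f then cinner (a e) (a e) else 0)"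
    using assms by (intro sum.cong refl) (auto simp: orthonormal_def)
  also have "\<dots> = complex_of_real (\<Sum>e\<in>E. (norm (a e))\<^sup>2)"
    using assms by (simp add: cinner_self orthonormal_def)
  finally show ?thesis by (simp only: of_real_eq_iff)
qed

text \<open>The operator \<open>A \<otimes> I\<close> is obtained by closing its graph over the elementary tensors.  The
  closure is again a graph with full domain, because \<open>A \<otimes> I\<close> is bounded on finite sums: write
  the second factors in an orthonormal family.\<close>

definition elementary_graph :: "('a \<Rightarrow> 'a) \<Rightarrow> ('e \<times> 'e) set"
  where "elementary_graph A = {(t a b, t (A a) b) | a b. True}"

text \<open>Besides boundedness this gives well-definedness: two representations of one tensor as a
  finite sum have the same image, as a zero first component forces a zero second one.\<close>

lemma norm_graph_le:
  assumes A: "bounded_clinear A" and p: "p \<in> span (elementary_graph A)"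
  shows "norm (snd p) \<le> onorm A * norm (fst p)"
proof -
  have "\<exists>n a b. p = (\<Sum>j<(n::nat). (t (a j) (b j), t (A (a j)) (b j)))"
    using p
  proof (induction rule: span_induct_alt)
    case base
    then show ?case by (intro exI[of _ 0]) simp
  next
    case (step c x y)
    then obtain n a b where y: "y = (\<Sum>j<(n::nat). (t (a j) (b j), t (A (a j)) (b j)))" by blast
    obtain a' b' where x: "x = (t a' b', t (A a') b')"
      using step.hyps by (auto simp: elementary_graph_def)
    \<comment> \<open>The scalar is absorbed into the first tensor factor; linearity of
      \<open>A\<close> makes this consistent in both components.\<close>
    define a1 where "a1 = a(n := of_real c *\<^sub>C a')"
    define b1 where "b1 = b(n := b')"
    have cx: "c *\<^sub>R x = (t (of_real c *\<^sub>C a') b', t (A (of_real c *\<^sub>C a')) b')"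
      unfolding x scaleR_Pair scaleC_of_real[symmetric] scaleC_left bounded_clinear_scaleC[OF A]
      by (rule refl)
    have "(\<Sum>j<Suc n. (t (a1 j) (b1 j), t (A (a1 j)) (b1 j))) = y + c *\<^sub>R x"
      unfolding sum.lessThan_Suc y cx
      by (intro arg_cong2[of _ _ _ _ plus] sum.cong) (auto simp: a1_def b1_def)
    then show ?case by (metis add.commute)
  qed
  then obtain n a b where pn: "p = (\<Sum>j<(n::nat). (t (a j) (b j), t (A (a j)) (b j)))" by blast
  obtain E where E: "orthonormal E" and b: "\<And>j. j < n \<Longrightarrow> b j = (\<Sum>e\<in>E. cinner (b j) e *\<^sub>C e)"
    using orthonormal_expansion[of "{..<n}" b] by auto
  define a' where "a' e = (\<Sum>j<n. cinner (b j) e *\<^sub>C a j)" for e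
  have expand: "(\<Sum>j<n. t (x j) (b j)) = (\<Sum>e\<in>E. t (\<Sum>j<n. cinner (b j) e *\<^sub>C x j) e)" for x
  proof -
    have "(\<Sum>j<n. t (x j) (b j)) = (\<Sum>j<n. \<Sum>e\<in>E. cinner (b j) e *\<^sub>C t (x j) e)"
    proof (rule sum.cong[OF refl])
      fix j assume "j \<in> {..<n}"
      then have "t (x j) (b j) = t (x j) (\<Sum>e\<in>E. cinner (b j) e *\<^sub>C e)" using b by simp
      then show "t (x j) (b j) = (\<Sum>e\<in>E. cinner (b j) e *\<^sub>C t (x j) e)"
        by (simp only: bounded_clinear_sum[OF bounded_clinear_right] scaleC_right)
    qed
    also have "\<dots> = (\<Sum>e\<in>E. \<Sum>j<n. cinner (b j) e *\<^sub>C t (x j) e)" by (rule sum.swap)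
    finally show ?thesis
      by (simp only: bounded_clinear_sum[OF bounded_clinear_left] scaleC_left)
  qed
  have "fst p = (\<Sum>e\<in>E. t (a' e) e)" by (simp add: pn fst_sum expand a'_def)
  then have fst: "(norm (fst p))\<^sup>2 = (\<Sum>e\<in>E. (norm (a' e))\<^sup>2)"
    by (simp add: norm_sum_orthonormal[OF E])
  have "snd p = (\<Sum>e\<in>E. t (A (a' e)) e)"
    by (simp add: pn snd_sum expand a'_def bounded_clinear_sum[OF A] bounded_clinear_scaleC[OF A])
  then have "(norm (snd p))\<^sup>2 = (\<Sum>e\<in>E. (norm (A (a' e)))\<^sup>2)"
    by (simp add: norm_sum_orthonormal[OF E])
  also have "\<dots> \<le> (\<Sum>e\<in>E. (onorm A)\<^sup>2 * (norm (a' e))\<^sup>2)"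
    unfolding power_mult_distrib[symmetric]
    by (intro sum_mono power_mono bounded_clinear_norm_le A norm_ge_zero)
  also have "\<dots> = (onorm A * norm (fst p))\<^sup>2"
    by (simp add: fst power_mult_distrib sum_distrib_left)
  finally show ?thesis
    by (rule power2_le_imp_le)
      (intro mult_nonneg_nonneg onorm_pos_le bounded_clinear_linear A norm_ge_zero)
qed

text \<open>The set where two bounded operators agree is a closed subspace, and the elementary
  tensors span a dense one.\<close>

lemma tensor_ext:
  assumes "bounded_clinear S" "bounded_clinear T" "\<And>a b. S (t a b) = T (t a b)"
  shows "S = T"
proof -
  have lin: "bounded_linear S" "bounded_linear T"
    using assms by (auto intro: bounded_clinear_linear)
  have "closed {x. S x = T x}"
    by (intro closed_Collect_eq linear_continuous_on lin)
  moreover have "complex_vector.subspace {x. S x = T x}"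
    by (rule complex_vector.subspaceI)
      (simp_all add: linear_add linear_0 bounded_linear.linear lin assms bounded_clinear_scaleC)
  then have "complex_vector.span {t a b | a b. True} \<subseteq> {x. S x = T x}"
    by (rule complex_vector.span_minimal[rotated]) (auto simp: assms(3))
  ultimately have "closure (complex_vector.span {t a b | a b. True}) \<subseteq> {x. S x = T x}"
    by (intro closure_minimal)
  then show ?thesis unfolding dense by auto
qed

lemma tensor_op_ex:
  assumes A: "bounded_clinear A"
  shows "\<exists>!T. bounded_clinear T \<and> (\<forall>a b. T (t a b) = t (A a) (id b))"
proof -
  define K where "K = onorm A"
  have K: "K \<ge> 0" unfolding K_def by (intro onorm_pos_le bounded_clinear_linear A)
  define \<Gamma> where "\<Gamma> = closure (span (elementary_graph A))"
  have sub: "subspace \<Gamma>" unfolding \<Gamma>_def by (intro subspace_closure subspace_span)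
  have gen: "(t a b, t (A a) b) \<in> \<Gamma>" for a b
  proof -
    have "(t a b, t (A a) b) \<in> elementary_graph A" by (auto simp: elementary_graph_def)
    then show ?thesis unfolding \<Gamma>_def using span_base closure_subset by blast
  qed
  have "closed {p :: 'e \<times> 'e. norm (snd p) \<le> K * norm (fst p)}"
    by (intro closed_Collect_le continuous_intros)
  then have "\<Gamma> \<subseteq> {p. norm (snd p) \<le> K * norm (fst p)}"
    unfolding \<Gamma>_def using norm_graph_le[OF A] by (intro closure_minimal) (auto simp: K_def)
  then have bound: "norm y \<le> K * norm x" if "(x, y) \<in> \<Gamma>" for x y using that by force
  \<comment> \<open>The graph was closed from a real span in the product space, so invariance under
    complex scalars needs its own argument: \<open>h\<close> maps generators to generators and is
    continuous.\<close>
  have scale: "(c *\<^sub>C x, c *\<^sub>C y) \<in> \<Gamma>" if "(x, y) \<in> \<Gamma>" for c x y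
  proof -
    define h where "h p = (c *\<^sub>C fst p, c *\<^sub>C snd p)" for p :: "'e \<times> 'e"
    have h: "bounded_linear h"
      unfolding h_def
      by (intro bounded_linear_Pair bounded_linear_compose[OF bounded_linear_scaleC]
          bounded_linear_fst bounded_linear_snd)
    have "h ` elementary_graph A \<subseteq> elementary_graph A"
    proof (rule image_subsetI)
      fix p assume "p \<in> elementary_graph A"
      then obtain a b where "p = (t a b, t (A a) b)" by (auto simp: elementary_graph_def)
      then have "h p = (t (c *\<^sub>C a) b, t (A (c *\<^sub>C a)) b)"
        by (simp add: h_def scaleC_left bounded_clinear_scaleC[OF A])
      then show "h p \<in> elementary_graph A" unfolding elementary_graph_def by blast
    qed
    then have "h ` span (elementary_graph A) \<subseteq> span (elementary_graph A)"
      by (simp add: linear_span_image[OF bounded_linear.linear[OF h], symmetric] span_mono)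
    then have "closure (h ` span (elementary_graph A)) \<subseteq> \<Gamma>" unfolding \<Gamma>_def by (rule closure_mono)
    moreover have "h ` \<Gamma> \<subseteq> closure (h ` span (elementary_graph A))"
      unfolding \<Gamma>_def by (rule closure_bounded_linear_image_subset[OF h])
    ultimately have "h (x, y) \<in> \<Gamma>" using that by blast
    then show ?thesis by (simp add: h_def)
  qed
  \<comment> \<open>On \<open>\<Gamma>\<close> the first projection is bounded below, hence its
    image is complete and therefore closed. It contains all elementary tensors, so by density it is
    the whole space.\<close>
  have "complete (fst ` \<Gamma>)"
  proof (rule complete_isometric_image)
    show "0 < inverse (1 + K)" using K by simp
    show "\<forall>p\<in>\<Gamma>. inverse (1 + K) * norm p \<le> norm (fst p)"
    proof
      fix p assume "p \<in> \<Gamma>"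
      then have "norm (snd p) \<le> K * norm (fst p)" using bound[of "fst p" "snd p"] by simp
      moreover have "norm p \<le> norm (fst p) + norm (snd p)" using norm_Pair_le[of "fst p" "snd p"] by simp
      ultimately have "norm p \<le> (1 + K) * norm (fst p)" by (simp add: distrib_right)
      then show "inverse (1 + K) * norm p \<le> norm (fst p)" using K by (simp add: field_simps)
    qed
    show "complete \<Gamma>" unfolding \<Gamma>_def by (simp add: complete_eq_closed)
  qed (auto simp: sub bounded_linear_fst)
  then have "closed (fst ` \<Gamma>)" by (rule complete_imp_closed)
  moreover have "complex_vector.subspace (fst ` \<Gamma>)"
  proof (rule complex_vector.subspaceI)
    show "0 \<in> fst ` \<Gamma>" using subspace_0[OF sub] by force
    show "x + y \<in> fst ` \<Gamma>" if "x \<in> fst ` \<Gamma>" "y \<in> fst ` \<Gamma>" for x y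
      using that subspace_add[OF sub] by (metis (no_types, lifting) fst_add imageE imageI)
    show "c *\<^sub>C x \<in> fst ` \<Gamma>" if "x \<in> fst ` \<Gamma>" for c x
      using that scale by force
  qed
  then have "complex_vector.span {t a b | a b. True} \<subseteq> fst ` \<Gamma>"
    by (rule complex_vector.span_minimal[rotated]) (use gen in force)
  ultimately have "closure (complex_vector.span {t a b | a b. True}) \<subseteq> fst ` \<Gamma>"
    by (intro closure_minimal)
  then have "\<exists>y. (x, y) \<in> \<Gamma>" for x unfolding dense by force
  then obtain T where T: "\<And>x. (x, T x) \<in> \<Gamma>" by metis
  have unique: "T x = y" if "(x, y) \<in> \<Gamma>" for x y
    using bound[of 0 "T x - y"] subspace_diff[OF sub T[of x] that] by simp
  have "bounded_clinear T"
  proof (rule bounded_clinearI)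
    show "T (x + y) = T x + T y" for x y
      using subspace_add[OF sub T[of x] T[of y]] by (intro unique) simp
    show "T (c *\<^sub>C x) = c *\<^sub>C T x" for c x by (intro unique scale T)
    show "norm (T x) \<le> K * norm x" for x by (rule bound[OF T])
  qed
  moreover have "T (t a b) = t (A a) (id b)" for a b using gen unique by simp
  ultimately show ?thesis
    by (intro ex_ex1I) (blast, rule tensor_ext, auto)
qed

lemma bounded_clinear_tensor_op: "bounded_clinear A \<Longrightarrow> bounded_clinear (tensor_op t A id)"
  and tensor_op_tensor: "bounded_clinear A \<Longrightarrow> tensor_op t A id (t a b) = t (A a) b"
  using theI'[OF tensor_op_ex[of A]] unfolding tensor_op_def by auto

end

section \<open>The model map\<close>

lemma (in commuting_tuple) summable_prod_onorm:
  assumes "\<And>i. summable (\<lambda>n. onorm (C i ^^ n))"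
  shows "(\<lambda>\<alpha>. \<Prod>i\<in>UNIV. onorm (C i ^^ \<alpha> i)) summable_on UNIV"
proof -
  have "(\<lambda>n. norm (onorm (C i ^^ n))) summable_on UNIV" for i
    using assms onorm_funpow_nonneg by (intro norm_summable_imp_summable_on) simp
  then have "Infinite_Sum.abs_summable_on (\<lambda>\<alpha>. \<Prod>i\<in>UNIV. onorm (C i ^^ \<alpha> i)) (PiE UNIV (\<lambda>_. UNIV))"
    unfolding abs_summable_equivalent by (intro abs_summable_on_prod_PiE) auto
  then show ?thesis by (simp add: PiE_UNIV_domain abs_summable_summable)
qed

lemma commuting_tuple_adj:
  assumes "commuting_tuple C"
  shows "commuting_tuple (\<lambda>i. adj (C i))"
proof -
  interpret commuting_tuple C by fact
  show ?thesis
    by unfold_locales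
      (simp_all add: bounded_clinear_adj bounded commuting flip: adj_compose)
qed

lemma onorm_adj_le:
  assumes "bounded_clinear T"
  shows "onorm (adj T) \<le> onorm T"
  by (intro onorm_bound onorm_pos_le bounded_clinear_linear norm_adj_le assms)

text \<open>To be used with \<open>D i = adj (C i)\<close>. Summability of the norms themselves, not
  only of their squares, makes the series of \<open>embed\<close> converge absolutely.\<close>

locale shift_model = commuting_tuple D + hilbert_tensor t
  for D :: "'k::finite \<Rightarrow> 'h::chilbert_space \<Rightarrow> 'h"
    and t :: "'k hardy \<Rightarrow> 'h \<Rightarrow> 'e::chilbert_space" +
  assumes summ: "\<And>i. summable (\<lambda>n. onorm (D i ^^ n))"
begin

text \<open>Formally the product of the resolvents (I - z_i D_i)^(-1) applied to \<open>h\<close>,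
  expanded as a power series in z.\<close>

definition embed :: "'h \<Rightarrow> 'e"
  where "embed h = (\<Sum>\<^sub>\<infinity>\<alpha>. t (hmono \<alpha>) (op_mpow D \<alpha> h))"

definition weight :: "('k \<Rightarrow> nat) \<Rightarrow> real"
  where "weight \<alpha> = (\<Prod>i\<in>UNIV. onorm (D i ^^ \<alpha> i))"

lemma norm_embed_term: "norm (t (hmono \<alpha>) (op_mpow D \<alpha> h)) \<le> weight \<alpha> * norm h"
  by (simp add: norm_tensor norm_hmono norm_op_mpow_le weight_def)

lemma weight_summable: "(\<lambda>\<alpha>. weight \<alpha> * norm h) summable_on UNIV"
  unfolding weight_def by (intro summable_on_cmult_left summable_prod_onorm summ)

lemma embed_abs_summable: "(\<lambda>\<alpha>. norm (t (hmono \<alpha>) (op_mpow D \<alpha> h))) summable_on UNIV"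
  by (rule summable_on_comparison_test[OF weight_summable norm_embed_term]) simp

lemma embed_has_sum: "((\<lambda>\<alpha>. t (hmono \<alpha>) (op_mpow D \<alpha> h)) has_sum embed h) UNIV"
  unfolding embed_def by (rule has_sum_infsum[OF abs_summable_summable[OF embed_abs_summable]])

lemma bounded_clinear_embed: "bounded_clinear embed"
proof (rule bounded_clinearI)
  fix x y c
  have "op_mpow D \<alpha> (x + y) = op_mpow D \<alpha> x + op_mpow D \<alpha> y" for \<alpha>
    by (rule linear_add[OF bounded_linear.linear[OF bounded_clinear_linear[OF bounded_op_mpow]]])
  then have "((\<lambda>\<alpha>. t (hmono \<alpha>) (op_mpow D \<alpha> (x + y))) has_sum embed x + embed y) UNIV"
    using has_sum_add[OF embed_has_sum[of x] embed_has_sum[of y]] by (simp add: add_right)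
  then show "embed (x + y) = embed x + embed y" by (rule has_sum_unique[OF embed_has_sum])
  have "((\<lambda>\<alpha>. t (hmono \<alpha>) (op_mpow D \<alpha> (c *\<^sub>C x))) has_sum c *\<^sub>C embed x) UNIV"
    using has_sum_bounded_linear[OF bounded_linear_scaleC embed_has_sum[of x]]
    by (simp add: bounded_clinear_scaleC[OF bounded_op_mpow] scaleC_right)
  then show "embed (c *\<^sub>C x) = c *\<^sub>C embed x" by (rule has_sum_unique[OF embed_has_sum])
  have "norm (embed x) \<le> (\<Sum>\<^sub>\<infinity>\<alpha>. norm (t (hmono \<alpha>) (op_mpow D \<alpha> x)))"
    unfolding embed_def by (rule norm_infsum_bound[OF embed_abs_summable])
  also have "\<dots> \<le> (\<Sum>\<^sub>\<infinity>\<alpha>. weight \<alpha> * norm x)"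
    by (intro infsum_mono embed_abs_summable weight_summable norm_embed_term)
  also have "\<dots> = (\<Sum>\<^sub>\<infinity>\<alpha>. weight \<alpha>) * norm x" by (rule infsum_cmult_left')
  finally show "norm (embed x) \<le> (\<Sum>\<^sub>\<infinity>\<alpha>. weight \<alpha>) * norm x" .
qed

text \<open>The component of \<open>embed h\<close> at \<open>\<alpha> = 0\<close> is \<open>h\<close> itself.\<close>

lemma norm_embed_ge: "norm h \<le> norm (embed h)"
proof -
  let ?u = "t (hmono (\<lambda>_. 0)) h"
  have "((\<lambda>\<alpha>. inner (t (hmono \<alpha>) (op_mpow D \<alpha> h)) ?u) has_sum inner (embed h) ?u) UNIV"
    by (rule has_sum_bounded_linear[OF bounded_linear_inner_left embed_has_sum])
  moreover have "inner (t (hmono \<alpha>) (op_mpow D \<alpha> h)) ?u =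
      (if \<alpha> = (\<lambda>_. 0) then (norm h)\<^sup>2 else 0)" for \<alpha>
    by (auto simp: Re_cinner[symmetric] cinner_tensor cinner_hmono hcoef_hmono op_mpow_0 cinner_self)
  ultimately have "(norm h)\<^sup>2 = inner (embed h) ?u"
    using has_sum_unique[OF has_sum_single[of "\<lambda>_. 0" "(norm h)\<^sup>2"]] by simp
  also have "\<dots> \<le> norm (embed h) * norm ?u" by (rule norm_cauchy_schwarz)
  finally have "norm h * norm h \<le> norm (embed h) * norm h"
    by (simp add: norm_tensor norm_hmono power2_eq_square)
  then show ?thesis by (cases "h = 0") auto
qed

lemma inj_embed: "inj embed"
proof (rule injI)
  fix x y assume "embed x = embed y"
  then have "embed (x - y) = 0" by (simp add: bounded_clinear_diff[OF bounded_clinear_embed])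
  then show "x = y" using norm_embed_ge[of "x - y"] by simp
qed

text \<open>The backward shift kills the terms with \<open>\<alpha> i = 0\<close> and lowers the
  monomial in the others. After reindexing, the surplus factor \<open>D i\<close> acts on
  \<open>h\<close>.\<close>

lemma backward_shift_embed: "tensor_op t (adj (shift i)) id (embed h) = embed (D i h)"
proof -
  have A: "bounded_clinear (adj (shift i :: 'k hardy \<Rightarrow> _))"
    by (intro bounded_clinear_adj bounded_clinear_shift)
  have "((\<lambda>\<alpha>. tensor_op t (adj (shift i)) id (t (hmono \<alpha>) (op_mpow D \<alpha> h))) has_sum
      tensor_op t (adj (shift i)) id (embed h)) UNIV"
    by (rule has_sum_bounded_linear[OF bounded_clinear_linear[OF bounded_clinear_tensor_op[OF A]] embed_has_sum])
  moreover have "((\<lambda>\<alpha>. tensor_op t (adj (shift i)) id (t (hmono \<alpha>) (op_mpow D \<alpha> h))) has_sum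
      embed (D i h)) UNIV"
    by (rule has_sum_incr[OF embed_has_sum[of "D i h"], where i = i])
      (simp_all add: tensor_op_tensor[OF A] adj_shift_hmono, simp add: incr_def op_mpow_Suc)
  ultimately show ?thesis by (rule has_sum_unique)
qed

lemma closed_range_embed: "closed (range embed)"
proof (rule complete_imp_closed)
  have "\<forall>h\<in>UNIV. 1 * norm h \<le> norm (embed h)" by (simp add: norm_embed_ge)
  then show "complete (range embed)"
    using complete_isometric_image[of 1 UNIV embed] bounded_clinear_linear[OF bounded_clinear_embed]
    by (simp add: complete_UNIV)
qed

lemma subspace_range_embed: "complex_vector.subspace (range embed)"
proof (rule complex_vector.subspaceI)
  note lin = bounded_linear.linear[OF bounded_clinear_linear[OF bounded_clinear_embed]]
  show "0 \<in> range embed" using linear_0[OF lin] by (metis rangeI)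
  show "x + y \<in> range embed" if "x \<in> range embed" "y \<in> range embed" for x y
    using that by (auto simp flip: linear_add[OF lin])
  show "c *\<^sub>C x \<in> range embed" if "x \<in> range embed" for c x
    using that by (auto simp flip: bounded_clinear_scaleC[OF bounded_clinear_embed])
qed

lemma invertible_onto_embed: "invertible_onto embed (range embed)"
  unfolding invertible_onto_def
proof (intro conjI exI[of _ 1] ballI)
  show "bij_betw embed UNIV (range embed)" by (rule inj_on_imp_bij_betw[OF inj_embed])
  show "norm (inv embed y) \<le> 1 * norm y" if "y \<in> range embed" for y
    using norm_embed_ge[of "inv embed y"] f_inv_into_f[OF that] by simp
qed (rule bounded_clinear_embed)

end

theorem corollary3p6:
  fixes C :: "'k::finite \<Rightarrow> 'h::chilbert_space \<Rightarrow> 'h"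
    and b :: real
  assumes separable: "separable_space (euclidean :: 'h topology)"
    and bounded: "\<And>i. bounded_clinear (C i)"
    and commuting: "\<And>i j. C i \<circ> C j = C j \<circ> C i"
    and radius: "\<And>i. spectral_radius (C i) < 1"
    and b: "b = (\<Prod>i\<in>UNIV. suminf (\<lambda>n. (onorm (C i ^^ n))\<^sup>2))"
  shows "(\<forall>tensor :: 'k hardy \<Rightarrow> 'h \<Rightarrow> 'e::chilbert_space. hilbert_tensor_product tensor \<longrightarrow>
            (\<exists>(G :: 'e set) (Y :: 'h \<Rightarrow> 'e).
               closed G \<and> complex_vector.subspace G \<and>
               (\<forall>i. tensor_op tensor (adj (shift i)) id ` G \<subseteq> G) \<and>
               invertible_onto Y G \<and>
               (\<forall>i. adj (C i) = inv Y \<circ> tensor_op tensor (adj (shift i)) id \<circ> Y))) \<and>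
         (\<forall>q :: 'm::finite \<Rightarrow> 'm \<Rightarrow> 'k mpoly.
            onorm (op_matrix (\<lambda>s t. mpoly_op (q s t) C))
              \<le> sqrt b * (SUP z\<in>{z :: complex ^ 'k. \<forall>i. cmod (z $ i) \<le> 1}.
                   onorm ((*v) (\<chi> s t. mpoly_eval (q s t) z))))"
proof (intro conjI allI impI)
  interpret C: commuting_tuple C by unfold_locales (rule bounded, rule commuting)
  \<comment> \<open>Both forms are needed: the first powers for the convergence of
    \<open>embed\<close>, the squares for the constant b. Geometric decay gives them
    together.\<close>
  have decay: "summable (\<lambda>n. onorm (C i ^^ n)) \<and> summable (\<lambda>n. (onorm (C i ^^ n))\<^sup>2)" for i
  proof -
    obtain M q where q: "0 \<le> q" "q < 1" and Mq: "\<And>n. onorm (C i ^^ n) \<le> M * q ^ n"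
      using power_bound_of_spectral_radius[OF bounded radius] by blast
    have s: "summable (\<lambda>n. M * q ^ n)" "summable (\<lambda>n. M\<^sup>2 * (q\<^sup>2) ^ n)"
      using q by (auto intro!: summable_mult summable_geometric simp: power_less_one_iff abs_square_less_1)
    have "summable (\<lambda>n. onorm (C i ^^ n))"
      by (rule summable_comparison_test[OF _ s(1)]) (use Mq C.onorm_funpow_nonneg in auto)
    moreover have "(onorm (C i ^^ n))\<^sup>2 \<le> M\<^sup>2 * (q\<^sup>2) ^ n" for n
      using power_mono[OF Mq C.onorm_funpow_nonneg, of n 2]
      by (simp add: power_mult_distrib power_mult[symmetric] mult.commute)
    then have "summable (\<lambda>n. (onorm (C i ^^ n))\<^sup>2)"
      by (intro summable_comparison_test[OF _ s(2)]) auto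
    ultimately show ?thesis ..
  qed
  show "onorm (op_matrix (\<lambda>s t. mpoly_op (q s t) C))
      \<le> sqrt b * (SUP z\<in>{z :: complex ^ 'k. \<forall>i. cmod (z $ i) \<le> 1}.
           onorm ((*v) (\<chi> s t. mpoly_eval (q s t) z)))" for q :: "'m \<Rightarrow> 'm \<Rightarrow> 'k mpoly"
    unfolding b by (rule C.onorm_mpoly_op_matrix_le) (use decay in blast)
  fix tensor :: "'k hardy \<Rightarrow> 'h \<Rightarrow> 'e"
  assume tensor: "hilbert_tensor_product tensor"
  interpret D: shift_model "\<lambda>i. adj (C i)" tensor
  proof (intro shift_model.intro shift_model_axioms.intro hilbert_tensor.intro tensor)
    show "commuting_tuple (\<lambda>i. adj (C i))" by (rule commuting_tuple_adj) unfold_locales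
    show "summable (\<lambda>n. onorm (adj (C i) ^^ n))" for i
    proof (rule summable_comparison_test[OF _ conjunct1[OF decay]])
      have "norm (onorm (adj (C i) ^^ n)) \<le> onorm (C i ^^ n)" for n
        using onorm_adj_le[OF bounded_clinear_funpow[OF bounded]]
          onorm_pos_le[OF bounded_clinear_linear[OF bounded_clinear_funpow[OF bounded_clinear_adj[OF bounded]]]]
        by (simp add: adj_funpow[OF bounded])
      then show "\<exists>N. \<forall>n\<ge>N. norm (onorm (adj (C i) ^^ n)) \<le> onorm (C i ^^ n)" by blast
    qed
  qed
  show "\<exists>G Y. closed G \<and> complex_vector.subspace G \<and>
      (\<forall>i. tensor_op tensor (adj (shift i)) id ` G \<subseteq> G) \<and> invertible_onto Y G \<and>
      (\<forall>i. adj (C i) = inv Y \<circ> tensor_op tensor (adj (shift i)) id \<circ> Y)"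
  \<comment> \<open>The witnesses stay schematic and are fixed by the facts below as
    \<open>range D.embed\<close> and \<open>D.embed\<close>. Injectivity lets
    \<open>inv D.embed\<close> cancel in the intertwining relation.\<close>
  proof (intro exI conjI allI)
    show "tensor_op tensor (adj (shift i)) id ` range D.embed \<subseteq> range D.embed" for i
      by (auto simp: D.backward_shift_embed)
    show "adj (C i) = inv D.embed \<circ> tensor_op tensor (adj (shift i)) id \<circ> D.embed" for i
      by (simp add: fun_eq_iff D.backward_shift_embed inv_f_f[OF D.inj_embed])
  qed (rule D.closed_range_embed D.subspace_range_embed D.invertible_onto_embed)+
qed

end
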